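(* Consider a conservative Feller semi-group $(P_t)_{t\ge 0}$ on a Polish space $E$ and, for each $\nu\in\mathcal P(E)$, a jump rate $\lambda_\nu$ and a jump kernel $Q_\nu$ on $E$, as described in the context. Assume: (i) there exists $\lambda_*$ such that $\lambda_\nu(x)\le\lambda_*$ for all $\nu\in\mathcal P(E)$ and $x\in E$; (ii) there exists $\theta>0$ such that for all $\nu_1,\nu_2\in\mathcal P(E)$, $$\sup_{\|f\|_\infty\le 1}\big\|\lambda_{\nu_1}(Q_{\nu_1}f-f)-\lambda_{\nu_2}(Q_{\nu_2}f-f)\big\|_\infty\le\theta\,\|\nu_1-\nu_2\|_{TV};$$ (iii) there exist $t_0>0$ and $\alpha\ge 0$ such that for all $x,y\in E$, $\|\delta_xP_{t_0}-\delta_yP_{t_0}\|_{TV}\le 2(1-\alpha)$. If $t\mapsto m_t$ and $t\mapsto h_t$ are solutions (in the sense of the context) of $$\partial_t m_t=L'm_t+Q'_{m_t}(\lambda_{m_t}m_t)-\lambda_{m_t}m_t$$ with respective initial distributions $m_0,h_0\in\mathcal P(E)$, then for all $t\ge 0$, $$\|m_t-h_t\|_{TV}\le e^{\theta t_0}\big(e^{\theta t_0}-\alpha e^{-\lambda_*t_0}\big)^{\lfloor t/t_0\rfloor}\|m_0-h_0\|_{TV}.$$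
   Context: $E$ is a Polish space, $\mathcal P(E)$ the set of Borel probability measures on $E$, $\mathcal D(E)$ the set of càdlàg functions $\mathbb R_+\to E$ with the Skorokhod topology, $\|\nu_1-\nu_2\|_{TV}=\sup_{\|f\|_\infty\le1}|(\nu_1-\nu_2)(f)|$ (supremum over measurable $f$). $(P_t)_{t\ge0}$ is a conservative Feller semi-group on $E$ with generator $L$; for each $x\in E$, $(Z^x_t)_{t\ge0}$ is an associated càdlàg strong Markov process with $Z_0^x=x$ and $P_tf(x)=\mathbb E f(Z^x_t)$. $A'$ denotes the dual on measures of an operator $A$ on functions. For each $\nu\in\mathcal P(E)$, $\lambda_\nu:E\to\mathbb R_+$ is measurable and $Q_\nu$ is a Markov kernel on $E$ (also viewed as the operator $Q_\nu f(x)=\int f\,dQ_\nu(x)$). $G_\nu:E\times[0,1]\to E$ is a representation of $Q_\nu$: if $U$ is uniform on $[0,1]$ then $G_\nu(x,U)\sim Q_\nu(x)$ for all $x$. Similarly $H:(x,u)\in E\times[0,1]\mapsto(H_t(x,u))_{t\ge0}\in\mathcal D(E)$ is a representation of $x\mapsto Law((Z^x_t)_{t\ge0})$. The maps $(\nu,x)\mapsto\lambda_\nu(x)$ and $(\nu,x,u)\mapsto G_\nu(x,u)$ are taken measurable so that the construction below makes sense. $\mathcal M(\mathbb R_+,\mathcal P(E))$ is the set of measurable functions $\mathbb R_+\to\mathcal P(E)$. Process $X^{\mu,x}$. Assume $\lambda_\nu(x)\le\lambda_*$ for all $\nu,x$. Let $\mu\in\mathcal M(\mathbb R_+,\mathcal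 P(E))$, $x\in E$, and let $(S_k,U_k,V_k,W_k)_{k\in\mathbb N}$ be i.i.d. with independent components, $S_k$ exponential of parameter 1 and $U_k,V_k,W_k$ uniform on $[0,1]$. Put $T_0=0$, $X_0^{\mu,x}=x$, $T_{n+1}=T_n+S_n/\lambda_*$. For $t\in(T_n,T_{n+1})$ put $X_t^{\mu,x}=H_{t-T_n}(X_{T_n}^{\mu,x},U_n)$. With $\tilde x=H_{S_n/\lambda_*}(X^{\mu,x}_{T_n},U_n)$: if $V_n\le\lambda_{\mu_{T_{n+1}}}(\tilde x)/\lambda_*$ put $X_{T_{n+1}}^{\mu,x}=G_{\mu_{T_{n+1}}}(\tilde x,W_n)$, otherwise put $X_{T_{n+1}}^{\mu,x}=\tilde x$. Set $R^\mu_{s,t}f(x)=\mathbb E f(X^{\sigma_s\mu,x}_{t-s})$ for $0\le s\le t$, where $(\sigma_s\mu)_t=\mu_{s+t}$. A solution with initial distribution $m_0$ is an $m\in\mathcal M(\mathbb R_+,\mathcal P(E))$ such that $m_0R^m_{0,t}=m_t$ for all $t\ge0$. *)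

theory Defs
  imports "HOL-Probability.Probability"
begin

section \<open>Measures and norms\<close>

abbreviation prob_measures :: "'e::topological_space measure set" where
  "prob_measures \<equiv> space (prob_algebra borel)"

definition bounded_measurable :: "('e::topological_space \<Rightarrow> real) set" where
  "bounded_measurable = {f \<in> borel_measurable borel. bounded (range f)}"

definition measurable_unit_ball :: "('e::topological_space \<Rightarrow> real) set" where
  "measurable_unit_ball = {f \<in> borel_measurable borel. \<forall>x. \<bar>f x\<bar> \<le> 1}"

definition sup_norm :: "('e \<Rightarrow> real) \<Rightarrow> real" where
  "sup_norm g = (SUP x. \<bar>g x\<bar>)"

text \<open>The norm of \<open>\<nu>\<^sub>1 - \<nu>\<^sub>2\<close> is normalised so that mutually singular probability measures are at
  distance 2. The supremum is that of a bounded set when both arguments are probability measures.\<close>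

definition tv_norm :: "'e::topological_space measure \<Rightarrow> 'e measure \<Rightarrow> real" where
  "tv_norm \<nu>1 \<nu>2 = (SUP f\<in>measurable_unit_ball. (\<integral>x. f x \<partial>\<nu>1) - (\<integral>x. f x \<partial>\<nu>2))"

abbreviation unif01 :: "real measure" where
  "unif01 \<equiv> restrict_space lborel {0..1}"

abbreviation measure_flows :: "(real \<Rightarrow> 'e::topological_space measure) set" where
  "measure_flows \<equiv> restrict_space borel {0..} \<rightarrow>\<^sub>M prob_algebra borel"


section \<open>The Skorokhod space\<close>

definition cadlag_paths :: "(real \<Rightarrow> 'e::topological_space) set" where
  "cadlag_paths = {w \<in> extensional {0..}.
     (\<forall>t\<ge>0. (w \<longlongrightarrow> w t) (at_right t)) \<and> (\<forall>t>0. \<exists>l. (w \<longlongrightarrow> l) (at_left t))}"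

definition time_changes :: "(real \<Rightarrow> real) set" where
  "time_changes = {c. c 0 = 0 \<and> strict_mono_on {0..} c \<and> continuous_on {0..} c \<and>
     filterlim c at_top at_top}"

definition skorokhod_converges ::
    "(nat \<Rightarrow> real \<Rightarrow> 'e::metric_space) \<Rightarrow> (real \<Rightarrow> 'e) \<Rightarrow> bool" where
  "skorokhod_converges v w \<longleftrightarrow> (\<exists>c. (\<forall>n. c n \<in> time_changes) \<and>
     uniform_limit {0..} c (\<lambda>t. t) sequentially \<and>
     (\<forall>N::nat. uniform_limit {0..real N} (\<lambda>n t. v n (c n t)) w sequentially))"

text \<open>The Skorokhod (J1) topology on paths over the half-line is the metrizable topology whose
  convergent sequences are those of \<^const>\<open>skorokhod_converges\<close>. Being metrizable, it is
  determined by them: its open sets are the sequentially open ones.\<close>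

definition skorokhod_open :: "(real \<Rightarrow> 'e::metric_space) set \<Rightarrow> bool" where
  "skorokhod_open U \<longleftrightarrow> U \<subseteq> cadlag_paths \<and>
     (\<forall>w\<in>U. \<forall>v. range v \<subseteq> cadlag_paths \<longrightarrow> skorokhod_converges v w \<longrightarrow>
        (\<forall>\<^sub>F n in sequentially. v n \<in> U))"

definition skorokhod_topology :: "(real \<Rightarrow> 'e::metric_space) topology" where
  "skorokhod_topology = topology skorokhod_open"

lemma istopology_skorokhod_open: "istopology skorokhod_open"
  unfolding istopology_def
proof (intro conjI allI impI)
  fix S T :: "(real \<Rightarrow> 'e::metric_space) set"
  assume "skorokhod_open S" "skorokhod_open T"
  then show "skorokhod_open (S \<inter> T)"
    unfolding skorokhod_open_def by (auto intro: eventually_conj)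
next
  fix K :: "(real \<Rightarrow> 'e::metric_space) set set"
  assume K: "\<forall>S\<in>K. skorokhod_open S"
  show "skorokhod_open (\<Union>K)"
    unfolding skorokhod_open_def
  proof (intro conjI ballI allI impI)
    show "\<Union>K \<subseteq> cadlag_paths"
      using K by (auto simp: skorokhod_open_def)
  next
    fix w v
    assume "w \<in> \<Union>K" "range v \<subseteq> cadlag_paths" "skorokhod_converges v w"
    then obtain S where "S \<in> K" "\<forall>\<^sub>F n in sequentially. v n \<in> S"
      using K unfolding skorokhod_open_def by blast
    then show "\<forall>\<^sub>F n in sequentially. v n \<in> \<Union>K"
      by (auto elim: eventually_mono)
  qed
qed

lemma openin_skorokhod_topology: "openin skorokhod_topology U \<longleftrightarrow> skorokhod_open U"
  unfolding skorokhod_topology_def by (simp add: topology_inverse'[OF istopology_skorokhod_open])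

definition skorokhod_borel :: "(real \<Rightarrow> 'e::metric_space) measure" where
  "skorokhod_borel = sigma cadlag_paths {U. openin skorokhod_topology U}"


section \<open>Feller semigroups and their processes\<close>

text \<open>The operator \<open>P\<^sub>t\<close> is given by its kernel: \<open>P\<^sub>t f (x)\<close> is the integral of \<open>f\<close> under \<open>P t x\<close>,
  and \<open>P t x\<close> is also the measure \<open>\<delta>\<^sub>x P\<^sub>t\<close>. The semigroup is conservative because
  every \<open>P t x\<close> has mass 1. A Polish space need not be locally compact, so the Feller property
  refers to bounded continuous functions.\<close>

definition feller_semigroup :: "(real \<Rightarrow> 'e::polish_space \<Rightarrow> 'e measure) \<Rightarrow> bool" where
  "feller_semigroup P \<longleftrightarrow>
     (\<forall>t\<ge>0. P t \<in> borel \<rightarrow>\<^sub>M prob_algebra borel) \<and>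
     (\<forall>x. P 0 x = return borel x) \<and>
     (\<forall>s\<ge>0. \<forall>t\<ge>0. \<forall>x. P (s + t) x = P s x \<bind> P t) \<and>
     (\<forall>f::'e \<Rightarrow> real. continuous_on UNIV f \<and> bounded (range f) \<longrightarrow>
        (\<forall>t\<ge>0. continuous_on UNIV (\<lambda>x. \<integral>y. f y \<partial>P t x)) \<and>
        (\<forall>x. ((\<lambda>t. \<integral>y. f y \<partial>P t x) \<longlongrightarrow> f x) (at_right 0)))"

text \<open>Stopping times are real-valued, hence finite. Since \<open>T\<close> is nonnegative,
  the part of the filtration with negative indices plays no role.\<close>

definition cadlag_strong_markov ::
    "(real \<Rightarrow> 'e::polish_space \<Rightarrow> 'e measure) \<Rightarrow> 'w measure \<Rightarrow> (real \<Rightarrow> 'w measure) \<Rightarrow>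
     (real \<Rightarrow> 'w \<Rightarrow> 'e) \<Rightarrow> bool" where
  "cadlag_strong_markov P M F Z \<longleftrightarrow>
     prob_space M \<and> filtration (space M) F \<and> (\<forall>t. subalgebra M (F t)) \<and>
     (\<forall>t\<ge>0. Z t \<in> F t \<rightarrow>\<^sub>M borel) \<and>
     (\<forall>\<omega>\<in>space M. (\<lambda>t\<in>{0..}. Z t \<omega>) \<in> cadlag_paths) \<and>
     (\<forall>T. stopping_time F T \<and> (\<forall>\<omega>\<in>space M. 0 \<le> T \<omega>) \<longrightarrow>
        (\<forall>t\<ge>0. \<forall>f\<in>bounded_measurable. AE \<omega> in M.
           real_cond_exp M (filtration.pre_sigma (space M) F T) (\<lambda>\<omega>. f (Z (T \<omega> + t) \<omega>)) \<omega>
             = (\<integral>y. f y \<partial>P t (Z (T \<omega>) \<omega>))))"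

definition path_law :: "'w measure \<Rightarrow> (real \<Rightarrow> 'w \<Rightarrow> 'e::metric_space) \<Rightarrow> (real \<Rightarrow> 'e) measure" where
  "path_law M Z = distr M skorokhod_borel (\<lambda>\<omega>. \<lambda>t\<in>{0..}. Z t \<omega>)"


section \<open>The jump process and the nonlinear equation\<close>

text \<open>The sample \<open>\<omega> k\<close> is the quadruple \<open>(S\<^sub>k, U\<^sub>k, V\<^sub>k, W\<^sub>k)\<close>.\<close>

type_synonym noise = "nat \<Rightarrow> real \<times> real \<times> real \<times> real"

definition jump_noise :: "noise measure" where
  "jump_noise = (\<Pi>\<^sub>M k\<in>UNIV.
     density lborel (exponential_density 1) \<Otimes>\<^sub>M unif01 \<Otimes>\<^sub>M unif01 \<Otimes>\<^sub>M unif01)"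

abbreviation noise_S :: "noise \<Rightarrow> nat \<Rightarrow> real" where "noise_S \<omega> k \<equiv> fst (\<omega> k)"
abbreviation noise_U :: "noise \<Rightarrow> nat \<Rightarrow> real" where "noise_U \<omega> k \<equiv> fst (snd (\<omega> k))"
abbreviation noise_V :: "noise \<Rightarrow> nat \<Rightarrow> real" where "noise_V \<omega> k \<equiv> fst (snd (snd (\<omega> k)))"
abbreviation noise_W :: "noise \<Rightarrow> nat \<Rightarrow> real" where "noise_W \<omega> k \<equiv> snd (snd (snd (\<omega> k)))"

primrec jump_time :: "real \<Rightarrow> noise \<Rightarrow> nat \<Rightarrow> real" where
  "jump_time lmax \<omega> 0 = 0"
| "jump_time lmax \<omega> (Suc n) = jump_time lmax \<omega> n + noise_S \<omega> n / lmax"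

text \<open>\<open>jump_chain \<dots> n\<close> is the value of the process at the \<open>n\<close>-th jump time.\<close>

primrec jump_chain ::
    "real \<Rightarrow> ('e measure \<Rightarrow> 'e \<Rightarrow> real) \<Rightarrow> ('e measure \<Rightarrow> 'e \<Rightarrow> real \<Rightarrow> 'e) \<Rightarrow>
     ('e \<Rightarrow> real \<Rightarrow> real \<Rightarrow> 'e) \<Rightarrow> (real \<Rightarrow> 'e measure) \<Rightarrow> 'e \<Rightarrow> noise \<Rightarrow> nat \<Rightarrow> 'e" where
  "jump_chain lmax rate G H \<mu> x \<omega> 0 = x"
| "jump_chain lmax rate G H \<mu> x \<omega> (Suc n) =
     (let y = H (jump_chain lmax rate G H \<mu> x \<omega> n) (noise_U \<omega> n) (noise_S \<omega> n / lmax);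
          \<nu> = \<mu> (jump_time lmax \<omega> (Suc n))
      in if noise_V \<omega> n \<le> rate \<nu> y / lmax then G \<nu> y (noise_W \<omega> n) else y)"

text \<open>Almost surely the jump times increase strictly to infinity, and then the index \<open>n\<close> below is
  the one with \<open>T\<^sub>n \<le> t < T\<^sub>n\<^sub>+\<^sub>1\<close>.\<close>

definition jump_process ::
    "real \<Rightarrow> ('e measure \<Rightarrow> 'e \<Rightarrow> real) \<Rightarrow> ('e measure \<Rightarrow> 'e \<Rightarrow> real \<Rightarrow> 'e) \<Rightarrow>
     ('e \<Rightarrow> real \<Rightarrow> real \<Rightarrow> 'e) \<Rightarrow> (real \<Rightarrow> 'e measure) \<Rightarrow> 'e \<Rightarrow> real \<Rightarrow> noise \<Rightarrow> 'e" where
  "jump_process lmax rate G H \<mu> x t \<omega> =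
     (let n = (LEAST n. t < jump_time lmax \<omega> (Suc n));
          y = jump_chain lmax rate G H \<mu> x \<omega> n
      in if t = jump_time lmax \<omega> n then y else H y (noise_U \<omega> n) (t - jump_time lmax \<omega> n))"

definition flow_semigroup ::
    "real \<Rightarrow> ('e measure \<Rightarrow> 'e \<Rightarrow> real) \<Rightarrow> ('e measure \<Rightarrow> 'e \<Rightarrow> real \<Rightarrow> 'e) \<Rightarrow>
     ('e \<Rightarrow> real \<Rightarrow> real \<Rightarrow> 'e) \<Rightarrow> (real \<Rightarrow> 'e measure) \<Rightarrow> real \<Rightarrow> real \<Rightarrow> ('e \<Rightarrow> real) \<Rightarrow> 'e \<Rightarrow> real" where
  "flow_semigroup lmax rate G H \<mu> s t f x =
     (\<integral>\<omega>. f (jump_process lmax rate G H (\<lambda>r. \<mu> (s + r)) x (t - s) \<omega>) \<partial>jump_noise)"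

definition nonlinear_solution ::
    "real \<Rightarrow> ('e measure \<Rightarrow> 'e \<Rightarrow> real) \<Rightarrow> ('e measure \<Rightarrow> 'e \<Rightarrow> real \<Rightarrow> 'e) \<Rightarrow>
     ('e \<Rightarrow> real \<Rightarrow> real \<Rightarrow> 'e) \<Rightarrow> 'e::polish_space measure \<Rightarrow> (real \<Rightarrow> 'e measure) \<Rightarrow> bool" where
  "nonlinear_solution lmax rate G H m0 m \<longleftrightarrow>
     m \<in> measure_flows \<and>
     (\<forall>t\<ge>0. \<forall>f\<in>bounded_measurable.
        (\<integral>x. flow_semigroup lmax rate G H m 0 t f x \<partial>m0) = (\<integral>x. f x \<partial>m t))"

end

theory Submission
  imports Defs
begin

text \<open>
  The free process is watched at the ringing times of a Poisson clock of rate \<open>lmax\<close>; at each ring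
  a jump is proposed and accepted with probability \<open>rate / lmax\<close>. Conditioning on the first ring
  \<open>\<tau>\<close>, an exponential time, gives for \<open>r(s,t) f\<close>, the function \<^term>\<open>flow_semigroup lmax rate G H \<mu> s t f\<close>,
  the integral equation

    \<open>r(s,t) f = E [ if t - s < \<tau> then P(t-s) f else P(\<tau>) K(\<mu>(s+\<tau>)) r(s+\<tau>,t) f ]\<close>,

  where \<open>K(\<nu>) f = f + (rate \<nu> / lmax) (Q(\<nu>) f - f)\<close> averages over the outcome of a proposed jump
  (lemma \<open>evol_first_jump\<close>). Everything else is deduced from this equation. Between two solutions
  of equations of this form, a bound \<open>b + M\<close> on their difference improves to \<open>b + c M\<close> with
  \<open>c < 1\<close> the probability of \<open>\<tau> \<le> t - s\<close>, so iterating removes \<open>M\<close> (\<open>le_if_contraction\<close>). This argument replaces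
  a Gronwall lemma, and it never integrates a total variation distance over time, whose
  measurability would have to be established first. It gives

    \<^item> uniqueness, hence the flow property \<open>r(s,t) = r(s,a) r(a,t)\<close>, because both sides satisfy the
      same equation on \<open>[s,a]\<close> (\<open>evol_restart\<close>, \<open>evol_evol\<close>);
    \<^item> stability: if \<open>\<parallel>m u - h u\<parallel> \<le> B(u)\<close>, then the functions \<open>r(s,t) f\<close> belonging to \<open>m\<close> and to
      \<open>h\<close> differ by at most \<open>\<theta>\<close> times the integral of \<open>B\<close> over \<open>[s,t]\<close> (\<open>evol_diff_le\<close>).

  A solution satisfies \<open>m t = m s r(s,t)\<close>. Writing \<open>\<parallel>m t - h t\<parallel>\<close> as a difference of initial laws
  under one evolution plus a difference of evolutions, stability yields \<open>\<parallel>m t - h t\<parallel> \<le>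
  exp(\<theta>(t-s)) \<parallel>m s - h s\<parallel>\<close> (\<open>tv_norm_gronwall\<close>). Over a period \<open>t0\<close> the clock stays silent with
  probability \<open>exp(-lmax t0)\<close>, and then the minorisation hypothesis on \<open>P t0\<close> applies. Hence
  \<open>r(s,s+t0) f\<close> has oscillation at most \<open>2 (1 - \<alpha> exp(-lmax t0))\<close> (\<open>evol_oscillation_le\<close>), the
  contribution of the initial laws contracts by the factor \<open>1 - \<alpha> exp(-lmax t0)\<close>, and that of the
  interaction is at most \<open>(exp(\<theta> t0) - 1) \<parallel>m s - h s\<parallel>\<close>. The factor per period is therefore
  \<open>exp(\<theta> t0) - \<alpha> exp(-lmax t0)\<close>, and the incomplete last period costs at most \<open>exp(\<theta> t0)\<close>
  (\<open>tv_norm_contraction\<close>).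

  Two measurability questions precede this. Evaluation of a path at a time is Skorokhod measurable
  because \<open>{w. \<exists>q\<in>(a,b). w q \<in> V}\<close> is open for open \<open>V\<close>, and right-continuity expresses the value at
  \<open>t\<close> through such events. The paths of \<open>Z\<close> form a Skorokhod measurable map because their image
  measure is the law of \<open>H\<close>, which is a probability measure (\<open>measurable_if_distr_prob_space\<close>).
\<close>

section \<open>Evaluation of cadlag paths\<close>

text \<open>The time changes tend to the identity, so a visit of \<open>w\<close> to \<open>V\<close> at a time \<open>q\<close> inside the open
  interval is followed by visits of the approximating paths at the times \<open>c n q\<close>, which
  eventually lie in the interval too. Fixed times would not do: evaluation at a time is not
  continuous at a path that jumps there.\<close>

lemma skorokhod_open_visits:
  fixes V :: "'e::metric_space set"
  assumes "open V" "0 \<le> a"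
  shows "skorokhod_open {w \<in> cadlag_paths. \<exists>q\<in>{a<..<b}. w q \<in> V}"
  unfolding skorokhod_open_def
proof (intro conjI ballI allI impI)
  fix w :: "real \<Rightarrow> 'e" and v
  assume "w \<in> {w \<in> cadlag_paths. \<exists>q\<in>{a<..<b}. w q \<in> V}"
    and v: "range v \<subseteq> cadlag_paths" and conv: "skorokhod_converges v w"
  then obtain q where q: "a < q" "q < b" "w q \<in> V" by auto
  from conv obtain c where c: "uniform_limit {0..} c (\<lambda>t. t) sequentially"
    and vc: "\<And>N::nat. uniform_limit {0..real N} (\<lambda>n t. v n (c n t)) w sequentially"
    unfolding skorokhod_converges_def by blast
  have cq: "(\<lambda>n. c n q) \<longlonglongrightarrow> q"
    using tendsto_uniform_limitI[OF c, of q] q(1) assms(2) by simp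
  obtain N :: nat where "q \<le> real N" using real_arch_simple by blast
  then have vq: "(\<lambda>n. v n (c n q)) \<longlonglongrightarrow> w q"
    using tendsto_uniform_limitI[OF vc[of N], of q] q(1) assms(2) by simp
  have "\<forall>\<^sub>F n in sequentially. c n q \<in> {a<..<b}"
    using topological_tendstoD[OF cq, of "{a<..<b}"] q by simp
  moreover have "\<forall>\<^sub>F n in sequentially. v n (c n q) \<in> V"
    using topological_tendstoD[OF vq assms(1) q(3)] .
  ultimately show "\<forall>\<^sub>F n in sequentially. v n \<in> {w \<in> cadlag_paths. \<exists>q\<in>{a<..<b}. w q \<in> V}"
    by eventually_elim (use v in auto)
qed auto

lemma space_skorokhod_borel: "space skorokhod_borel = cadlag_paths"
  by (simp add: skorokhod_borel_def space_measure_of_conv)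

lemma sets_skorokhod_borel_visits:
  fixes V :: "'e::metric_space set"
  assumes "open V" "0 \<le> a"
  shows "{w \<in> cadlag_paths. \<exists>q\<in>{a<..<b}. w q \<in> V} \<in> sets skorokhod_borel"
proof -
  have "{U. openin skorokhod_topology U} \<subseteq> Pow (cadlag_paths :: (real \<Rightarrow> 'e) set)"
    by (auto simp: openin_skorokhod_topology skorokhod_open_def)
  then show ?thesis
    unfolding skorokhod_borel_def
    by (simp add: sets_measure_of)
      (rule sigma_sets.Basic, simp add: openin_skorokhod_topology skorokhod_open_visits assms)
qed

text \<open>This describes the value at \<open>t\<close> by countably many events that a path avoids an open set during
  an open time interval. The thickening of \<open>C\<close> makes up for the fact that \<open>w q\<close> is only close to
  \<open>C\<close> for times \<open>q\<close> just after \<open>t\<close>.\<close>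

lemma cadlag_value_closed_iff:
  fixes w :: "real \<Rightarrow> 'e::metric_space"
  assumes w: "w \<in> cadlag_paths" and t: "0 \<le> t" and C: "closed C" "C \<noteq> {}"
  shows "w t \<in> C \<longleftrightarrow>
    (\<forall>k. \<exists>n. \<not> (\<exists>q\<in>{t<..<t + 1 / real (Suc n)}. w q \<in> {x. 1 / real (Suc k) < infdist x C}))"
proof -
  have rc: "((\<lambda>q. infdist (w q) C) \<longlongrightarrow> infdist (w t) C) (at_right t)"
    using w t by (intro tendsto_infdist) (auto simp: cadlag_paths_def)
  have right: "\<forall>\<^sub>F q in at_right t. q \<in> {t<..<t + 1 / real (Suc n)}" for n
    using eventually_at_right_less[of t] eventually_at_right_real[of t "t + 1 / real (Suc n)"]
    by simp
  show ?thesis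
  proof (intro iffI allI)
    fix k assume "w t \<in> C"
    then have "\<forall>\<^sub>F q in at_right t. infdist (w q) C < 1 / real (Suc k)"
      using rc by (intro order_tendstoD(2)) auto
    then obtain b where b: "b > t" "\<And>q. t < q \<Longrightarrow> q < b \<Longrightarrow> infdist (w q) C < 1 / real (Suc k)"
      by (auto simp: eventually_at_right_field)
    obtain n where n: "1 / real (Suc n) < b - t"
      using b(1) nat_approx_posE[of "b - t"] by auto
    have "infdist (w q) C < 1 / real (Suc k)" if "q \<in> {t<..<t + 1 / real (Suc n)}" for q
      using that n by (intro b(2)) auto
    then show "\<exists>n. \<not> (\<exists>q\<in>{t<..<t + 1 / real (Suc n)}. w q \<in> {x. 1 / real (Suc k) < infdist x C})"
      by (intro exI[of _ n]) (metis mem_Collect_eq order_less_asym)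
  next
    assume *: "\<forall>k. \<exists>n. \<not> (\<exists>q\<in>{t<..<t + 1 / real (Suc n)}. w q \<in> {x. 1 / real (Suc k) < infdist x C})"
    have "infdist (w t) C \<le> 1 / real (Suc k)" for k
    proof -
      obtain n where n: "\<And>q. q \<in> {t<..<t + 1 / real (Suc n)} \<Longrightarrow> infdist (w q) C \<le> 1 / real (Suc k)"
        using * by (metis mem_Collect_eq not_less)
      have "\<forall>\<^sub>F q in at_right t. infdist (w q) C \<le> 1 / real (Suc k)"
        using right[of n] by eventually_elim (rule n)
      then show ?thesis by (intro tendsto_upperbound[OF rc]) auto
    qed
    then have "infdist (w t) C \<le> 0"
    proof -
      assume le: "\<And>k. infdist (w t) C \<le> 1 / real (Suc k)"
      show ?thesis
      proof (rule ccontr)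
        assume "\<not> infdist (w t) C \<le> 0"
        then obtain n where "1 / real (Suc n) < infdist (w t) C"
          using nat_approx_posE[of "infdist (w t) C"] by auto
        with le[of n] show False by simp
      qed
    qed
    then show "w t \<in> C"
      using C infdist_nonneg[of "w t" C] by (simp add: in_closed_iff_infdist_zero)
  qed
qed

lemma measurable_cadlag_eval_at:
  assumes t: "0 \<le> t"
  shows "(\<lambda>w. w t) \<in> skorokhod_borel \<rightarrow>\<^sub>M (borel :: 'e::metric_space measure)"
  unfolding borel_eq_closed
proof (rule measurable_measure_of)
  fix C :: "'e set" assume "C \<in> Collect closed"
  show "(\<lambda>w. w t) -` C \<inter> space skorokhod_borel \<in> sets skorokhod_borel"
  proof (cases "C = {}")
    case False
    have eq: "(\<lambda>w. w t) -` C \<inter> space skorokhod_borel = (\<Inter>k. \<Union>n. space skorokhod_borel -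
        {w \<in> cadlag_paths. \<exists>q\<in>{t<..<t + 1 / real (Suc n)}. w q \<in> {x. 1 / real (Suc k) < infdist x C}})"
      using \<open>C \<in> Collect closed\<close>
      by (intro set_eqI) (simp add: space_skorokhod_borel cadlag_value_closed_iff[OF _ t _ False] conj_commute cong: conj_cong)
    have "open {x. 1 / real (Suc k) < infdist x C}" for k
      by (intro open_Collect_less continuous_intros)
    then show ?thesis
      unfolding eq by (intro sets.countable_INT sets.countable_UN image_subsetI sets.compl_sets
          sets_skorokhod_borel_visits t) auto
  qed simp
qed auto

text \<open>By right-continuity \<open>w t\<close> is the limit of the values of \<open>w\<close> at the grid points
  \<open>(\<lfloor>(n+1) t\<rfloor> + 1) / (n+1)\<close>, which lie strictly to the right of \<open>t\<close>. At negative times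
  all paths take the same default value.\<close>

lemma measurable_cadlag_eval:
  "(\<lambda>(w, t). w t) \<in> skorokhod_borel \<Otimes>\<^sub>M borel \<rightarrow>\<^sub>M (borel :: 'e::metric_space measure)"
proof -
  let ?r = "\<lambda>n (t::real). real (Suc (nat \<lfloor>real (Suc n) * t\<rfloor>)) / real (Suc n)"
  let ?M = "skorokhod_borel \<Otimes>\<^sub>M borel :: ((real \<Rightarrow> 'e) \<times> real) measure"
  have approx: "(\<lambda>(w, t). if 0 \<le> t then w (?r n t) else undefined) \<in> ?M \<rightarrow>\<^sub>M borel" for n
  proof -
    have [measurable]: "(\<lambda>w. w (real (Suc k) / real (Suc n))) \<in> skorokhod_borel \<rightarrow>\<^sub>M (borel :: 'e measure)" for k
      by (rule measurable_cadlag_eval_at) simp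
    have [measurable]: "(\<lambda>z. fst z (real (Suc (nat \<lfloor>real (Suc n) * snd z\<rfloor>)) / real (Suc n))) \<in> ?M \<rightarrow>\<^sub>M borel"
      by (rule measurable_compose_countable[where g="\<lambda>z. nat \<lfloor>real (Suc n) * snd z\<rfloor>"
            and f="\<lambda>k z. fst z (real (Suc k) / real (Suc n))"]) measurable
    show ?thesis unfolding split_beta by measurable
  qed
  have "(\<lambda>n. if 0 \<le> t then w (?r n t) else undefined) \<longlonglongrightarrow> w t" if w: "w \<in> cadlag_paths" for w :: "real \<Rightarrow> 'e" and t
  proof (cases "0 \<le> t")
    case True
    have lb: "t < ?r n t" for n
    proof -
      have "real (Suc n) * t < real (Suc (nat \<lfloor>real (Suc n) * t\<rfloor>))"
        using True by (simp add: of_nat_nat) linarith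
      then show ?thesis by (simp add: field_simps)
    qed
    have ub: "?r n t \<le> t + 1 / real (Suc n)" for n
    proof -
      have "real (Suc (nat \<lfloor>real (Suc n) * t\<rfloor>)) \<le> real (Suc n) * t + 1"
        using True by (simp add: of_nat_nat)
      then have "?r n t \<le> (real (Suc n) * t + 1) / real (Suc n)"
        by (intro divide_right_mono) auto
      then show ?thesis by (simp add: add_divide_distrib del: of_nat_Suc)
    qed
    have up: "(\<lambda>n. t + 1 / real (Suc n)) \<longlonglongrightarrow> t"
      using tendsto_add[OF tendsto_const LIMSEQ_Suc[OF lim_1_over_n], of t] by simp
    have "(\<lambda>n. ?r n t) \<longlonglongrightarrow> t"
      by (rule tendsto_sandwich[OF always_eventually[OF allI[OF less_imp_le[OF lb]]]
            always_eventually[OF allI[OF ub]] tendsto_const up])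
    then have "filterlim (\<lambda>n. ?r n t) (at_right t) sequentially"
      unfolding filterlim_at using lb by (auto intro!: always_eventually simp del: of_nat_Suc simp: less_imp_neq[symmetric])
    then show ?thesis
      using w True filterlim_compose[of w "nhds (w t)" "at_right t"]
      by (auto simp: cadlag_paths_def)
  next
    case False
    then have "w t = undefined"
      using w by (auto simp: cadlag_paths_def extensional_def)
    then show ?thesis using False by simp
  qed
  then show ?thesis
    by (intro borel_measurable_LIMSEQ_metric[OF approx])
      (auto simp: space_pair_measure space_skorokhod_borel)
qed

text \<open>The image of a measure under an arbitrary map is defined so that a set with non-measurable
  preimage gets mass 0, or so that the whole image measure vanishes. If the preimage of \<open>A\<close> were not
  measurable, neither would be that of its complement, and both masses, which add up to 1, would be 0.\<close>

lemma measurable_if_distr_prob_space: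
  assumes "prob_space M" and X: "X \<in> space M \<rightarrow> space N" and D: "prob_space (distr M N X)"
  shows "X \<in> M \<rightarrow>\<^sub>M N"
proof (rule measurableI)
  interpret M: prob_space M by fact
  let ?\<mu> = "\<lambda>A. emeasure M (X -` A \<inter> space M)"
  have eD: "emeasure (distr M N X) A = (if measure_space (space N) (sets N) ?\<mu> then ?\<mu> A else 0)"
    if "A \<in> sets N" for A
    using that unfolding distr_def by (simp add: emeasure_measure_of_conv sets.space_closed sets.sigma_sets_eq)
  have one: "emeasure (distr M N X) (space N) = 1"
    using prob_space.emeasure_space_1[OF D] by simp
  then have ms: "measure_space (space N) (sets N) ?\<mu>"
    using eD[of "space N"] by (auto split: if_splits)
  fix A assume A: "A \<in> sets N"
  have XN: "X -` (space N - A) \<inter> space M = space M - (X -` A \<inter> space M)"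
    using X by auto
  have split: "?\<mu> A + ?\<mu> (space N - A) = 1"
  proof -
    have "emeasure (distr M N X) A + emeasure (distr M N X) (space N - A) = emeasure (distr M N X) (space N)"
      using A sets.sets_into_space[OF A] by (subst plus_emeasure) (auto simp: Un_absorb1 Un_commute)
    then show ?thesis using one ms A by (simp add: eD)
  qed
  show "X -` A \<inter> space M \<in> sets M"
  proof (rule ccontr)
    assume n: "X -` A \<inter> space M \<notin> sets M"
    then have "X -` (space N - A) \<inter> space M \<notin> sets M"
      unfolding XN by (metis Diff_Diff_Int Int_absorb1 Int_lower2 sets.compl_sets)
    with n split show False by (simp add: emeasure_notin_sets)
  qed
qed (use X in auto)

section \<open>The driving noise\<close>

lemma prob_space_unif01: "prob_space unif01"
  by (rule prob_spaceI) (simp add: emeasure_restrict_space space_restrict_space)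

lemma (in prob_space) integrable_bounded:
  fixes f :: "'a \<Rightarrow> real"
  assumes "f \<in> borel_measurable M" "\<And>x. x \<in> space M \<Longrightarrow> \<bar>f x\<bar> \<le> C"
  shows "integrable M f"
  using assms by (intro integrable_const_bound[where B=C]) auto

lemma (in prob_space) abs_integral_le_bound:
  fixes f :: "'a \<Rightarrow> real"
  assumes C: "0 \<le> C" "\<And>x. x \<in> space M \<Longrightarrow> \<bar>f x\<bar> \<le> C"
  shows "\<bar>\<integral>x. f x \<partial>M\<bar> \<le> C"
proof (cases "integrable M f")
  case True
  have "\<bar>\<integral>x. f x \<partial>M\<bar> \<le> (\<integral>x. \<bar>f x\<bar> \<partial>M)" by (rule integral_abs_bound)
  also have "\<dots> \<le> (\<integral>x. C \<partial>M)" using True C by (intro integral_mono) auto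
  finally show ?thesis by (simp add: prob_space)
qed (simp add: C not_integrable_integral_eq)

lemma Fubini_prob_bounded:
  fixes f :: "'a \<times> 'b \<Rightarrow> real"
  assumes "prob_space M" "prob_space N"
    and f: "f \<in> borel_measurable (M \<Otimes>\<^sub>M N)"
    and C: "\<And>x y. x \<in> space M \<Longrightarrow> y \<in> space N \<Longrightarrow> \<bar>f (x, y)\<bar> \<le> C"
  shows "(\<integral>z. f z \<partial>(M \<Otimes>\<^sub>M N)) = (\<integral>x. \<integral>y. f (x, y) \<partial>N \<partial>M)"
    and "(\<integral>x. \<integral>y. f (x, y) \<partial>N \<partial>M) = (\<integral>y. \<integral>x. f (x, y) \<partial>M \<partial>N)"
proof -
  interpret M: prob_space M by fact
  interpret N: prob_space N by fact
  interpret MN: pair_prob_space M N ..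
  have int: "integrable (M \<Otimes>\<^sub>M N) f"
    using f C by (intro MN.integrable_bounded[where C=C]) (auto simp: space_pair_measure)
  show "(\<integral>z. f z \<partial>(M \<Otimes>\<^sub>M N)) = (\<integral>x. \<integral>y. f (x, y) \<partial>N \<partial>M)"
    using MN.integral_fst'[OF int] by simp
  show "(\<integral>x. \<integral>y. f (x, y) \<partial>N \<partial>M) = (\<integral>y. \<integral>x. f (x, y) \<partial>M \<partial>N)"
    using MN.Fubini_integral[of "\<lambda>x y. f (x, y)"] int by simp
qed

abbreviation exp_law :: "real \<Rightarrow> real measure" where
  "exp_law l \<equiv> density lborel (exponential_density l)"

abbreviation noise_law :: "(real \<times> real \<times> real \<times> real) measure" where
  "noise_law \<equiv> exp_law 1 \<Otimes>\<^sub>M unif01 \<Otimes>\<^sub>M unif01 \<Otimes>\<^sub>M unif01"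

lemma prob_space_exp_law: "0 < l \<Longrightarrow> prob_space (exp_law l)"
  by (rule prob_space_exponential_density)

lemma prob_space_pair_measure:
  assumes "prob_space M" "prob_space N" shows "prob_space (M \<Otimes>\<^sub>M N)"
proof -
  interpret M: prob_space M by fact
  interpret N: prob_space N by fact
  interpret pair_prob_space M N ..
  show ?thesis by (rule prob_space_axioms)
qed

lemma prob_space_noise_law: "prob_space noise_law"
  by (intro prob_space_pair_measure prob_space_unif01 prob_space_exp_law) simp

lemma prob_space_jump_noise: "prob_space jump_noise"
  unfolding jump_noise_def by (intro prob_space_PiM prob_space_noise_law)

lemma sets_jump_noise[measurable_cong]: "sets jump_noise = sets (\<Pi>\<^sub>M k\<in>(UNIV::nat set). noise_law)"
  by (simp add: jump_noise_def)

text \<open>The renewal structure behind every conditioning on the first ring.\<close>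

lemma jump_noise_shift:
  "distr (noise_law \<Otimes>\<^sub>M jump_noise) jump_noise (\<lambda>(z, \<omega>). case_nat z \<omega>) = jump_noise"
proof -
  interpret prob_space noise_law by (rule prob_space_noise_law)
  interpret sequence_space noise_law ..
  show ?thesis unfolding jump_noise_def by (rule PiM_iter)
qed

lemma measurable_case_nat_noise[measurable]:
  "(\<lambda>(z, \<omega>). case_nat z \<omega>) \<in> noise_law \<Otimes>\<^sub>M jump_noise \<rightarrow>\<^sub>M jump_noise"
  unfolding jump_noise_def by measurable

lemma integral_jump_noise_shift:
  fixes g :: "noise \<Rightarrow> real"
  assumes [measurable]: "g \<in> borel_measurable jump_noise" and C: "\<And>\<omega>. \<bar>g \<omega>\<bar> \<le> C"
  shows "(\<integral>\<omega>. g \<omega> \<partial>jump_noise) = (\<integral>z. \<integral>\<omega>. g (case_nat z \<omega>) \<partial>jump_noise \<partial>noise_law)"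
proof -
  have "(\<integral>\<omega>. g \<omega> \<partial>jump_noise) = (\<integral>x. g (case x of (z, \<omega>) \<Rightarrow> case_nat z \<omega>) \<partial>(noise_law \<Otimes>\<^sub>M jump_noise))"
    by (subst jump_noise_shift[symmetric], subst integral_distr) auto
  also have "\<dots> = (\<integral>z. \<integral>\<omega>. g (case_nat z \<omega>) \<partial>jump_noise \<partial>noise_law)"
    by (subst Fubini_prob_bounded(1)[OF prob_space_noise_law prob_space_jump_noise, where C=C])
      (auto simp: C)
  finally show ?thesis .
qed

lemma AE_noise_law_pos: "AE z in noise_law. 0 < fst z"
proof -
  interpret E: prob_space "exp_law 1" by (rule prob_space_exp_law) simp
  interpret U: prob_space "unif01 \<Otimes>\<^sub>M unif01 \<Otimes>\<^sub>M unif01"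
    by (intro prob_space_pair_measure prob_space_unif01)
  interpret EU: pair_prob_space "exp_law 1" "unif01 \<Otimes>\<^sub>M unif01 \<Otimes>\<^sub>M unif01" ..
  have "AE x in lborel. x \<noteq> (0::real)" by (rule AE_lborel_singleton)
  then have "AE x in exp_law 1. 0 < x"
    by (subst AE_density) (auto simp: exponential_density_def)
  moreover have "(\<lambda>z. fst z) \<in> noise_law \<rightarrow>\<^sub>M exp_law 1" by (rule measurable_fst)
  then have "(\<lambda>z. fst z) \<in> borel_measurable noise_law" by (simp cong: measurable_cong_sets)
  then have "{z \<in> space noise_law. 0 < fst z} \<in> sets noise_law"
    by (intro predE borel_measurable_less borel_measurable_const)
  ultimately show ?thesis
    by (intro EU.AE_pair_measure) auto
qed

lemma AE_noise_S_pos: "AE \<omega> in jump_noise. \<forall>n. 0 < noise_S \<omega> n"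
proof -
  have "AE \<omega> in jump_noise. 0 < fst (\<omega> n)" for n
    unfolding jump_noise_def
    by (intro AE_PiM_component[where P="\<lambda>z. 0 < fst z"] prob_space_noise_law AE_noise_law_pos) auto
  then show ?thesis by (simp add: AE_all_countable)
qed

lemma measurable_noise_S[measurable]: "(\<lambda>\<omega>. noise_S \<omega> n) \<in> borel_measurable jump_noise"
  and measurable_noise_U[measurable]: "(\<lambda>\<omega>. noise_U \<omega> n) \<in> jump_noise \<rightarrow>\<^sub>M unif01"
  and measurable_noise_V[measurable]: "(\<lambda>\<omega>. noise_V \<omega> n) \<in> jump_noise \<rightarrow>\<^sub>M unif01"
  and measurable_noise_W[measurable]: "(\<lambda>\<omega>. noise_W \<omega> n) \<in> jump_noise \<rightarrow>\<^sub>M unif01"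
proof -
  have "(\<lambda>\<omega>. \<omega> n) \<in> jump_noise \<rightarrow>\<^sub>M noise_law"
    unfolding jump_noise_def by measurable
  then have "(\<lambda>\<omega>. \<omega> n) \<in> jump_noise \<rightarrow>\<^sub>M (lborel \<Otimes>\<^sub>M unif01 \<Otimes>\<^sub>M unif01 \<Otimes>\<^sub>M unif01)"
    by (simp cong: measurable_cong_sets sets_pair_measure_cong)
  note [measurable] = this
  show "(\<lambda>\<omega>. noise_S \<omega> n) \<in> borel_measurable jump_noise"
    "(\<lambda>\<omega>. noise_U \<omega> n) \<in> jump_noise \<rightarrow>\<^sub>M unif01"
    "(\<lambda>\<omega>. noise_V \<omega> n) \<in> jump_noise \<rightarrow>\<^sub>M unif01"
    "(\<lambda>\<omega>. noise_W \<omega> n) \<in> jump_noise \<rightarrow>\<^sub>M unif01"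
    by measurable
qed

lemma measurable_jump_time[measurable]: "(\<lambda>\<omega>. jump_time l \<omega> n) \<in> borel_measurable jump_noise"
  by (induction n) auto

lemma jump_time_case_nat:
  "jump_time l (case_nat z \<omega>) (Suc n) = fst z / l + jump_time l \<omega> n"
  by (induction n) auto

lemma nn_integral_exp_law_exp:
  "(\<integral>\<^sup>+s. ennreal (exp (- s)) \<partial>exp_law 1) = 1 / 2"
proof -
  have "(\<integral>\<^sup>+s. ennreal (exp (- s)) \<partial>exp_law 1)
      = (\<integral>\<^sup>+s. ennreal (1/2 * exponential_density 2 s) \<partial>lborel)"
    by (subst nn_integral_density)
      (auto simp: exponential_density_def ennreal_mult[symmetric] exp_add[symmetric] intro!: nn_integral_cong)
  also have "\<dots> = ennreal (1/2) * (\<integral>\<^sup>+s. ennreal (exponential_density 2 s) \<partial>lborel)"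
    by (subst nn_integral_cmult[symmetric], simp, intro nn_integral_cong, rule ennreal_mult)
      (simp_all add: exponential_density_nonneg)
  also have "(\<integral>\<^sup>+s. ennreal (exponential_density 2 s) \<partial>lborel) = emeasure (exp_law 2) UNIV"
    by (simp add: emeasure_density)
  also have "emeasure (exp_law 2) UNIV = 1"
    using prob_space.emeasure_space_1[OF prob_space_exp_law[of 2]] by simp
  finally show ?thesis by (simp add: divide_ennreal_def)
qed

text \<open>The waiting times, rescaled by \<open>l\<close>, are independent standard exponentials, and each
  contributes the factor \<open>E exp(-S) = 1/2\<close>.\<close>

lemma nn_integral_exp_jump_time:
  assumes l: "0 < l"
  shows "(\<integral>\<^sup>+\<omega>. ennreal (exp (- l * jump_time l \<omega> n)) \<partial>jump_noise) = (1 / 2) ^ n"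
proof (induction n)
  case 0
  show ?case using prob_space.emeasure_space_1[OF prob_space_jump_noise] by simp
next
  case (Suc n)
  interpret J: prob_space jump_noise by (rule prob_space_jump_noise)
  interpret U: prob_space "unif01 \<Otimes>\<^sub>M unif01 \<Otimes>\<^sub>M unif01"
    by (intro prob_space_pair_measure prob_space_unif01)
  have "(\<integral>\<^sup>+\<omega>. ennreal (exp (- l * jump_time l \<omega> (Suc n))) \<partial>jump_noise)
      = (\<integral>\<^sup>+x. ennreal (exp (- l * jump_time l (case x of (z, \<omega>) \<Rightarrow> case_nat z \<omega>) (Suc n))) \<partial>(noise_law \<Otimes>\<^sub>M jump_noise))"
    by (subst jump_noise_shift[symmetric], subst nn_integral_distr) auto
  also have "\<dots> = (\<integral>\<^sup>+z. \<integral>\<^sup>+\<omega>. ennreal (exp (- l * jump_time l (case_nat z \<omega>) (Suc n))) \<partial>jump_noise \<partial>noise_law)"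
    by (subst J.nn_integral_fst[symmetric]) auto
  also have "\<dots> = (\<integral>\<^sup>+z. \<integral>\<^sup>+\<omega>. ennreal (exp (- fst z)) * ennreal (exp (- l * jump_time l \<omega> n)) \<partial>jump_noise \<partial>noise_law)"
    using l by (intro nn_integral_cong)
      (simp add: jump_time_case_nat ennreal_mult[symmetric] exp_add[symmetric] algebra_simps del: jump_time.simps)
  also have "\<dots> = (\<integral>\<^sup>+z. ennreal (exp (- fst z)) \<partial>noise_law) * (1 / 2) ^ n"
    by (simp add: nn_integral_cmult nn_integral_multc Suc[simplified])
  also have "(\<integral>\<^sup>+z. ennreal (exp (- fst z)) \<partial>noise_law) = (\<integral>\<^sup>+s. ennreal (exp (- s)) \<partial>exp_law 1)"
    by (subst U.nn_integral_fst[symmetric]) (auto simp: U.emeasure_space_1)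
  finally show ?case by (simp add: nn_integral_exp_law_exp)
qed

text \<open>By Markov's inequality \<open>T\<^sub>n \<le> k\<close> has probability at most \<open>exp(l k) / 2^n\<close>. The divergence of the
  jump times makes the index chosen by \<^const>\<open>jump_process\<close> the intended one.\<close>

lemma AE_jump_time_unbounded:
  assumes l: "0 < l"
  shows "AE \<omega> in jump_noise. \<forall>t. \<exists>n. t < jump_time l \<omega> n"
proof -
  interpret J: prob_space jump_noise by (rule prob_space_jump_noise)
  have "AE \<omega> in jump_noise. \<exists>n. real k < jump_time l \<omega> n" for k
  proof (rule AE_I)
    let ?A = "{\<omega> \<in> space jump_noise. \<not> (\<exists>n. real k < jump_time l \<omega> n)}"
    show A: "?A \<in> sets jump_noise" by measurable
    have le: "emeasure jump_noise ?A \<le> ennreal (exp (l * real k)) * (1 / 2) ^ n" for n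
    proof -
      have "emeasure jump_noise ?A = (\<integral>\<^sup>+\<omega>. indicator ?A \<omega> \<partial>jump_noise)"
        using A by simp
      also have "\<dots> \<le> (\<integral>\<^sup>+\<omega>. ennreal (exp (l * real k)) * ennreal (exp (- l * jump_time l \<omega> n)) \<partial>jump_noise)"
      proof (rule nn_integral_mono)
        fix \<omega>
        have "1 \<le> exp (l * real k + - l * jump_time l \<omega> n)" if "\<omega> \<in> ?A"
        proof -
          have "jump_time l \<omega> n \<le> real k" using that by (auto simp: not_less)
          then have "l * jump_time l \<omega> n \<le> l * real k" using l by (intro mult_left_mono) auto
          then show ?thesis by simp
        qed
        then show "indicator ?A \<omega> \<le> ennreal (exp (l * real k)) * ennreal (exp (- l * jump_time l \<omega> n))"
          by (auto simp: ennreal_mult[symmetric] exp_add[symmetric] split: split_indicator)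
      qed
      also have "\<dots> = ennreal (exp (l * real k)) * (1 / 2) ^ n"
        using nn_integral_exp_jump_time[OF l, of n] by (subst nn_integral_cmult) auto
      finally show ?thesis .
    qed
    have "(\<lambda>n. ennreal (exp (l * real k) * (1 / 2) ^ n)) \<longlonglongrightarrow> ennreal (exp (l * real k) * 0)"
      by (intro tendsto_ennrealI tendsto_mult tendsto_const LIMSEQ_power_zero) auto
    moreover have "ennreal (exp (l * real k) * (1 / 2) ^ n) = ennreal (exp (l * real k)) * (1 / 2) ^ n" for n
      by (simp add: ennreal_mult ennreal_power[symmetric] divide_ennreal[symmetric] del: ennreal_half)
    ultimately have "(\<lambda>n. ennreal (exp (l * real k)) * (1 / 2) ^ n) \<longlonglongrightarrow> 0" by simp
    then have "emeasure jump_noise ?A \<le> 0"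
      using le by (intro LIMSEQ_le_const[of _ 0]) auto
    then show "emeasure jump_noise ?A = 0" by simp
  qed auto
  then have "AE \<omega> in jump_noise. \<forall>k. \<exists>n. real k < jump_time l \<omega> n"
    by (simp add: AE_all_countable)
  then show ?thesis
  proof eventually_elim
    fix \<omega> assume "\<forall>k. \<exists>n. real k < jump_time l \<omega> n"
    then show "\<forall>t. \<exists>n. t < jump_time l \<omega> n"
      by (meson less_trans reals_Archimedean2)
  qed
qed

definition post_jump where
  "post_jump l rate G \<nu> y v w = (if v \<le> rate \<nu> y / l then G \<nu> y w else y)"

text \<open>Renewal at the first ring: the rest of the chain is driven by the remaining noise, and the flow
  is advanced by the waiting time.\<close>

lemma jump_chain_case_nat:
  "jump_chain l rate G H \<mu> x (case_nat z \<omega>) (Suc n) =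
    jump_chain l rate G H (\<lambda>r. \<mu> (fst z / l + r))
      (post_jump l rate G (\<mu> (fst z / l)) (H x (fst (snd z)) (fst z / l)) (fst (snd (snd z))) (snd (snd (snd z)))) \<omega> n"
proof (induction n)
  case 0
  show ?case by (simp add: post_jump_def Let_def)
next
  case (Suc n)
  show ?case
    by (subst jump_chain.simps(2), subst Suc, subst jump_time_case_nat)
      (simp add: Let_def del: jump_time.simps)
qed

lemma jump_process_case_nat:
  assumes l: "0 < l" and s: "0 < fst z" and t: "0 \<le> t"
    and unb: "\<forall>t. \<exists>n. t < jump_time l \<omega> n"
  shows "jump_process l rate G H \<mu> x t (case_nat z \<omega>) =
    (if t < fst z / l then (if t = 0 then x else H x (fst (snd z)) t)
     else jump_process l rate G H (\<lambda>r. \<mu> (fst z / l + r))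
      (post_jump l rate G (\<mu> (fst z / l)) (H x (fst (snd z)) (fst z / l)) (fst (snd (snd z))) (snd (snd (snd z))))
      (t - fst z / l) \<omega>)"
proof (cases "t < fst z / l")
  case True
  then have "(LEAST n. t < jump_time l (case_nat z \<omega>) (Suc n)) = 0"
    by (intro Least_eq_0) (simp add: jump_time_case_nat del: jump_time.simps(2))
  then show ?thesis using True by (simp add: jump_process_def Let_def)
next
  case False
  let ?P = "\<lambda>n. t < jump_time l (case_nat z \<omega>) (Suc n)"
  obtain n where n: "t - fst z / l < jump_time l \<omega> n" using unb by blast
  then have "?P n" by (simp add: jump_time_case_nat algebra_simps del: jump_time.simps(2))
  moreover have "\<not> ?P 0" using False by simp
  ultimately have "(LEAST n. ?P n) = Suc (LEAST n. ?P (Suc n))" by (rule Least_Suc)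
  also have "(LEAST n. ?P (Suc n)) = (LEAST n. t - fst z / l < jump_time l \<omega> (Suc n))"
    by (simp only: jump_time_case_nat) (simp add: algebra_simps del: jump_time.simps)
  finally show ?thesis
    using False unfolding jump_process_def
    by (simp add: Let_def jump_time_case_nat jump_chain_case_nat algebra_simps
        del: jump_time.simps jump_chain.simps(2))
qed

text \<open>The flow is evaluated at jump times only, and these are nonnegative.\<close>

lemma jump_process_cong_flow:
  assumes l: "0 < l" and S: "\<forall>n. 0 < noise_S \<omega> n" and eq: "\<And>r. 0 \<le> r \<Longrightarrow> \<mu> r = \<nu> r"
  shows "jump_process l rate G H \<mu> x t \<omega> = jump_process l rate G H \<nu> x t \<omega>"
proof -
  have T: "0 \<le> jump_time l \<omega> n" for n
    using l S by (induction n) (auto intro!: add_nonneg_nonneg divide_nonneg_nonneg simp: less_imp_le)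
  have "jump_chain l rate G H \<mu> x \<omega> n = jump_chain l rate G H \<nu> x \<omega> n" for n
    by (induction n) (simp_all add: eq[OF T] del: jump_time.simps)
  then show ?thesis by (simp add: jump_process_def)
qed

lemma distr_exp_law_scale:
  assumes l: "0 < l"
  shows "distr (exp_law 1) borel (\<lambda>s. s / l) = exp_law l"
proof (rule measure_eqI)
  fix A assume "A \<in> sets (distr (exp_law 1) borel (\<lambda>s. s / l))"
  then have [measurable]: "A \<in> sets borel" by simp
  have "emeasure (distr (exp_law 1) borel (\<lambda>s. s / l)) A
      = (\<integral>\<^sup>+s. ennreal (exponential_density 1 s) * indicator A (s / l) \<partial>lborel)"
    by (subst nn_integral_indicator[symmetric], simp, subst nn_integral_distr)
      (simp_all add: nn_integral_density)
  also have "\<dots> = ennreal l * (\<integral>\<^sup>+s. ennreal (exponential_density 1 (l * s)) * indicator A s \<partial>lborel)"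
    using l by (subst nn_integral_real_affine[where c=l and t=0]) auto
  also have "\<dots> = (\<integral>\<^sup>+s. ennreal (exponential_density l s) * indicator A s \<partial>lborel)"
    using l by (subst nn_integral_cmult[symmetric])
      (auto simp: exponential_density_def mult_less_0_iff ennreal_mult mult_ac zero_less_mult_iff intro!: nn_integral_cong)
  also have "\<dots> = emeasure (exp_law l) A" by (simp add: emeasure_density)
  finally show "emeasure (distr (exp_law 1) borel (\<lambda>s. s / l)) A = emeasure (exp_law l) A" .
qed simp

section \<open>The equation of the first ring\<close>

interpretation unif01: prob_space unif01 by (rule prob_space_unif01)
interpretation jump_noise: prob_space jump_noise by (rule prob_space_jump_noise)

lemma measure_unif01: "measure unif01 {0..1} = 1"
  using unif01.prob_space by simp

lemma AE_exp_law_pos: "AE \<tau> in exp_law l. 0 < \<tau>"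
proof -
  have "AE x in lborel. x \<noteq> (0::real)" by (rule AE_lborel_singleton)
  then show ?thesis
    by (subst AE_density) (auto simp: exponential_density_def)
qed

lemma measurable_unif01_borel: "f \<in> M \<rightarrow>\<^sub>M unif01 \<Longrightarrow> f \<in> borel_measurable M"
  by (simp add: measurable_restrict_space2_iff)

lemma unit_ballD:
  assumes "f \<in> measurable_unit_ball"
  shows "f \<in> borel_measurable borel" "\<bar>f x\<bar> \<le> 1"
  using assms by (auto simp: measurable_unit_ball_def)

text \<open>The data that the first-ring equation depends on. The representation of the free process enters
  only through its joint measurability in (state, noise, time) and its one-dimensional laws.\<close>

locale jump_model =
  fixes P :: "real \<Rightarrow> 'e::polish_space \<Rightarrow> 'e measure"
    and rate :: "'e measure \<Rightarrow> 'e \<Rightarrow> real"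
    and G :: "'e measure \<Rightarrow> 'e \<Rightarrow> real \<Rightarrow> 'e" and H :: "'e \<Rightarrow> real \<Rightarrow> real \<Rightarrow> 'e"
    and lmax :: real
  assumes P_kernel: "\<And>t. 0 \<le> t \<Longrightarrow> P t \<in> borel \<rightarrow>\<^sub>M prob_algebra borel"
    and P_zero: "\<And>x. P 0 x = return borel x"
    and P_semigroup: "\<And>s t x. 0 \<le> s \<Longrightarrow> 0 \<le> t \<Longrightarrow> P (s + t) x = P s x \<bind> P t"
    and rate_measurable: "(\<lambda>(\<nu>, x). rate \<nu> x) \<in> prob_algebra borel \<Otimes>\<^sub>M borel \<rightarrow>\<^sub>M borel"
    and rate_bounds: "\<And>\<nu> x. \<nu> \<in> prob_measures \<Longrightarrow> 0 \<le> rate \<nu> x \<and> rate \<nu> x \<le> lmax"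
    and G_measurable:
      "(\<lambda>(\<nu>, x, u). G \<nu> x u) \<in> prob_algebra borel \<Otimes>\<^sub>M borel \<Otimes>\<^sub>M unif01 \<rightarrow>\<^sub>M borel"
    and H_measurable: "(\<lambda>(x, u, t). H x u t) \<in> borel \<Otimes>\<^sub>M unif01 \<Otimes>\<^sub>M borel \<rightarrow>\<^sub>M borel"
    and H_law: "\<And>t x. 0 \<le> t \<Longrightarrow> distr unif01 borel (\<lambda>u. H x u t) = P t x"
    and lmax_pos: "0 < lmax"
begin

sublocale clock: prob_space "exp_law lmax" by (rule prob_space_exp_law[OF lmax_pos])

text \<open>This is \<open>P\<^sub>t f (x)\<close>. Writing it with the representation \<open>H\<close> makes its joint measurability in
  \<open>(t, x)\<close> immediate, also at negative times, where \<open>P t\<close> is arbitrary.\<close>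

definition heat :: "real \<Rightarrow> ('e \<Rightarrow> real) \<Rightarrow> 'e \<Rightarrow> real" where
  "heat t f x = (\<integral>u. f (H x u t) \<partial>unif01)"

text \<open>The transition operator of a proposed jump, \<open>f + (rate \<nu> / lmax) (Q\<^sub>\<nu> f - f)\<close>, where \<open>Q\<^sub>\<nu> y\<close> is the
  law of \<open>G \<nu> y\<close>.\<close>

definition jump_op :: "'e measure \<Rightarrow> ('e \<Rightarrow> real) \<Rightarrow> 'e \<Rightarrow> real" where
  "jump_op \<nu> f y = (\<integral>v. \<integral>w. f (post_jump lmax rate G \<nu> y v w) \<partial>unif01 \<partial>unif01)"

abbreviation evol :: "(real \<Rightarrow> 'e measure) \<Rightarrow> real \<Rightarrow> real \<Rightarrow> ('e \<Rightarrow> real) \<Rightarrow> 'e \<Rightarrow> real" where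
  "evol \<equiv> flow_semigroup lmax rate G H"

lemma measurable_rate[measurable (raw)]:
  assumes "\<nu> \<in> M \<rightarrow>\<^sub>M prob_algebra borel" "y \<in> borel_measurable M"
  shows "(\<lambda>x. rate (\<nu> x) (y x)) \<in> borel_measurable M"
  using measurable_compose[OF measurable_Pair[OF assms] rate_measurable] by simp

lemma measurable_G[measurable (raw)]:
  assumes "\<nu> \<in> M \<rightarrow>\<^sub>M prob_algebra borel" "y \<in> borel_measurable M" "w \<in> M \<rightarrow>\<^sub>M unif01"
  shows "(\<lambda>x. G (\<nu> x) (y x) (w x)) \<in> borel_measurable M"
  using measurable_compose[OF measurable_Pair[OF assms(1) measurable_Pair[OF assms(2,3)]] G_measurable]
  by simp

lemma measurable_H[measurable (raw)]:
  assumes "y \<in> borel_measurable M" "u \<in> M \<rightarrow>\<^sub>M unif01" "t \<in> borel_measurable M"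
  shows "(\<lambda>x. H (y x) (u x) (t x)) \<in> borel_measurable M"
  using measurable_compose[OF measurable_Pair[OF assms(1) measurable_Pair[OF assms(2,3)]] H_measurable]
  by simp

lemma measurable_post_jump[measurable (raw)]:
  assumes [measurable]: "\<nu> \<in> M \<rightarrow>\<^sub>M prob_algebra borel" "y \<in> borel_measurable M"
      "w \<in> M \<rightarrow>\<^sub>M unif01" and v: "v \<in> M \<rightarrow>\<^sub>M unif01"
  shows "(\<lambda>x. post_jump lmax rate G (\<nu> x) (y x) (v x) (w x)) \<in> borel_measurable M"
proof -
  note [measurable] = measurable_unif01_borel[OF v]
  show ?thesis unfolding post_jump_def by measurable
qed

lemma measurable_heat[measurable (raw)]:
  assumes [measurable]: "(\<lambda>(a, y). f a y) \<in> borel_measurable (M \<Otimes>\<^sub>M borel)"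
    "x \<in> borel_measurable M" "t \<in> borel_measurable M"
  shows "(\<lambda>a. heat (t a) (f a) (x a)) \<in> borel_measurable M"
  unfolding heat_def by measurable

lemma measurable_jump_op[measurable (raw)]:
  assumes [measurable]: "(\<lambda>(a, y). f a y) \<in> borel_measurable (M \<Otimes>\<^sub>M borel)"
    "\<nu> \<in> M \<rightarrow>\<^sub>M prob_algebra borel" "y \<in> borel_measurable M"
  shows "(\<lambda>a. jump_op (\<nu> a) (f a) (y a)) \<in> borel_measurable M"
  unfolding jump_op_def by measurable

text \<open>The flow is evaluated at \<open>s a + r\<close> with a starting time that may depend on the parameter,
  since the shift in the first-ring equation is the random time of the ring.\<close>

lemma measurable_jump_chain:
  assumes [measurable]: "\<mu> \<in> borel \<rightarrow>\<^sub>M prob_algebra borel" "s \<in> borel_measurable M"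
    "x \<in> borel_measurable M" "\<omega> \<in> M \<rightarrow>\<^sub>M jump_noise"
  shows "(\<lambda>a. jump_chain lmax rate G H (\<lambda>r. \<mu> (s a + r)) (x a) (\<omega> a) n) \<in> borel_measurable M"
proof (induction n)
  case (Suc n)
  note [measurable] = Suc measurable_compose[OF assms(4) measurable_noise_S]
    measurable_compose[OF assms(4) measurable_noise_U] measurable_compose[OF assms(4) measurable_noise_V]
    measurable_compose[OF assms(4) measurable_noise_W] measurable_compose[OF assms(4) measurable_jump_time]
  show ?case
    unfolding jump_chain.simps(2) Let_def post_jump_def[of lmax rate G, symmetric]
    by measurable
qed simp

lemma measurable_jump_process[measurable (raw)]:
  assumes [measurable]: "\<mu> \<in> borel \<rightarrow>\<^sub>M prob_algebra borel" "s \<in> borel_measurable M"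
    "x \<in> borel_measurable M" "t \<in> borel_measurable M" "\<omega> \<in> M \<rightarrow>\<^sub>M jump_noise"
  shows "(\<lambda>a. jump_process lmax rate G H (\<lambda>r. \<mu> (s a + r)) (x a) (t a) (\<omega> a)) \<in> borel_measurable M"
proof -
  note [measurable] = measurable_compose[OF assms(5) measurable_noise_S]
    measurable_compose[OF assms(5) measurable_noise_U] measurable_compose[OF assms(5) measurable_jump_time]
    measurable_jump_chain[OF assms(1,2,3,5)]
  show ?thesis
    unfolding jump_process_def Let_def
    by (rule measurable_compose_countable[where g="\<lambda>a. LEAST n. t a < jump_time lmax (\<omega> a) (Suc n)"
          and f="\<lambda>n a. if t a = jump_time lmax (\<omega> a) n
             then jump_chain lmax rate G H (\<lambda>r. \<mu> (s a + r)) (x a) (\<omega> a) n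
             else H (jump_chain lmax rate G H (\<lambda>r. \<mu> (s a + r)) (x a) (\<omega> a) n)
               (noise_U (\<omega> a) n) (t a - jump_time lmax (\<omega> a) n)"])
      (simp_all del: jump_time.simps)
qed

lemma measurable_evol[measurable (raw)]:
  assumes [measurable]: "\<mu> \<in> borel \<rightarrow>\<^sub>M prob_algebra borel" "f \<in> borel_measurable borel"
    "s \<in> borel_measurable M" "t \<in> borel_measurable M" "x \<in> borel_measurable M"
  shows "(\<lambda>a. evol \<mu> (s a) (t a) f (x a)) \<in> borel_measurable M"
  unfolding flow_semigroup_def by measurable

lemma abs_heat_le:
  assumes "0 \<le> C" "\<And>y. \<bar>f y\<bar> \<le> C"
  shows "\<bar>heat t f x\<bar> \<le> C"
  unfolding heat_def by (intro unif01.abs_integral_le_bound assms)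

lemma abs_jump_op_le:
  assumes "0 \<le> C" "\<And>y. \<bar>f y\<bar> \<le> C"
  shows "\<bar>jump_op \<nu> f y\<bar> \<le> C"
  unfolding jump_op_def by (intro unif01.abs_integral_le_bound assms)

lemma abs_evol_le:
  assumes "0 \<le> C" "\<And>y. \<bar>f y\<bar> \<le> C"
  shows "\<bar>evol \<mu> s t f x\<bar> \<le> C"
  unfolding flow_semigroup_def by (intro jump_noise.abs_integral_le_bound assms)

lemma evol_unit_ball:
  assumes "\<mu> \<in> borel \<rightarrow>\<^sub>M prob_algebra borel" "f \<in> measurable_unit_ball"
  shows "evol \<mu> s t f \<in> measurable_unit_ball"
proof -
  note [measurable] = assms(1) unit_ballD(1)[OF assms(2)]
  have "(\<lambda>x. evol \<mu> s t f x) \<in> borel_measurable borel" by measurable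
  then show ?thesis
    using abs_evol_le[of 1 f] unit_ballD(2)[OF assms(2)] by (auto simp: measurable_unit_ball_def)
qed

lemma integral_P_eq_heat:
  assumes [measurable]: "f \<in> borel_measurable borel" and t: "0 \<le> t"
  shows "(\<integral>y. f y \<partial>P t x) = heat t f x"
proof -
  have "(\<lambda>u. H x u t) \<in> unif01 \<rightarrow>\<^sub>M borel" by measurable
  then show ?thesis unfolding H_law[OF t, symmetric] heat_def
    by (intro integral_distr) auto
qed

lemma heat_zero: "f \<in> borel_measurable borel \<Longrightarrow> heat 0 f x = f x"
  using integral_P_eq_heat[of f 0 x] by (simp add: P_zero integral_return)

text \<open>The noise is split into its first quadruple and the rest. If the first ring comes after the
  elapsed time \<open>t - s\<close>, the process is still free; otherwise it restarts at the ring.\<close>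

theorem evol_first_jump:
  assumes \<mu>[measurable]: "\<mu> \<in> borel \<rightarrow>\<^sub>M prob_algebra borel"
    and f: "f \<in> measurable_unit_ball" and st: "s \<le> t"
  shows "evol \<mu> s t f x = (\<integral>\<tau>. (if t - s < \<tau> then heat (t - s) f x
      else heat \<tau> (jump_op (\<mu> (s + \<tau>)) (evol \<mu> (s + \<tau>) t f)) x) \<partial>exp_law lmax)"
proof -
  note f_meas[measurable] = unit_ballD(1)[OF f] and f1 = unit_ballD(2)[OF f]
  note l = lmax_pos
  \<comment> \<open>The expectation given the first quadruple, with the waiting time in the original time scale. The case \<open>t - s = 0\<close> is
    special because the process starts in \<open>x\<close>, whereas \<open>H x u 0\<close> equals \<open>x\<close> only almost surely.\<close>
  define \<Phi> where "\<Phi> \<tau> u v w = (if t - s < \<tau> then (if t - s = 0 then f x else f (H x u (t - s)))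
      else evol \<mu> (s + \<tau>) t f (post_jump lmax rate G (\<mu> (s + \<tau>)) (H x u \<tau>) v w))" for \<tau> u v w
  have \<Phi>1: "\<bar>\<Phi> \<tau> u v w\<bar> \<le> 1" for \<tau> u v w
    unfolding \<Phi>_def by (auto simp: f1 abs_evol_le)
  have \<Phi>_meas[measurable (raw)]: "(\<lambda>a. \<Phi> (\<tau> a) (u a) (v a) (w a)) \<in> borel_measurable M"
    if [measurable]: "\<tau> \<in> borel_measurable M" "u \<in> M \<rightarrow>\<^sub>M unif01" "v \<in> M \<rightarrow>\<^sub>M unif01" "w \<in> M \<rightarrow>\<^sub>M unif01"
    for M :: "'z measure" and \<tau> u v w
    unfolding \<Phi>_def by measurable
  let ?g = "\<lambda>\<omega>. f (jump_process lmax rate G H (\<lambda>r. \<mu> (s + r)) x (t - s) \<omega>)"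
  let ?\<Psi> = "\<lambda>z. \<Phi> (fst z / lmax) (fst (snd z)) (fst (snd (snd z))) (snd (snd (snd z)))"
  let ?UUU = "unif01 \<Otimes>\<^sub>M unif01 \<Otimes>\<^sub>M unif01"
  interpret E1: prob_space "exp_law 1" by (rule prob_space_exp_law) simp
  \<comment> \<open>Given the first quadruple, only the remaining noise is integrated out.\<close>
  have inner: "(\<integral>\<omega>. ?g (case_nat z \<omega>) \<partial>jump_noise) = ?\<Psi> z" if z: "0 < fst z" "z \<in> space noise_law" for z
  proof -
    have [measurable]: "(\<lambda>\<omega>. case_nat z \<omega>) \<in> jump_noise \<rightarrow>\<^sub>M jump_noise"
      using measurable_compose[OF measurable_Pair1'[OF z(2)] measurable_case_nat_noise] by simp
    have zs: "fst (snd z) \<in> space unif01" "fst (snd (snd z)) \<in> space unif01" "snd (snd (snd z)) \<in> space unif01"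
      using z(2) by (auto simp: space_pair_measure)
    have [measurable]: "(\<lambda>\<omega>. fst (snd z)) \<in> jump_noise \<rightarrow>\<^sub>M unif01" "(\<lambda>\<omega>. fst (snd (snd z))) \<in> jump_noise \<rightarrow>\<^sub>M unif01"
      "(\<lambda>\<omega>. snd (snd (snd z))) \<in> jump_noise \<rightarrow>\<^sub>M unif01"
      by (rule measurable_const, rule zs)+
    have "(\<integral>\<omega>. ?g (case_nat z \<omega>) \<partial>jump_noise) = (\<integral>\<omega>. (if t - s < fst z / lmax then (if t - s = 0 then f x else f (H x (fst (snd z)) (t - s)))
        else f (jump_process lmax rate G H (\<lambda>r. \<mu> (s + fst z / lmax + r))
         (post_jump lmax rate G (\<mu> (s + fst z / lmax)) (H x (fst (snd z)) (fst z / lmax)) (fst (snd (snd z))) (snd (snd (snd z))))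
         (t - (s + fst z / lmax)) \<omega>)) \<partial>jump_noise)"
    proof (rule integral_cong_AE)
      show "AE \<omega> in jump_noise. ?g (case_nat z \<omega>) = (if t - s < fst z / lmax then (if t - s = 0 then f x else f (H x (fst (snd z)) (t - s)))
        else f (jump_process lmax rate G H (\<lambda>r. \<mu> (s + fst z / lmax + r))
         (post_jump lmax rate G (\<mu> (s + fst z / lmax)) (H x (fst (snd z)) (fst z / lmax)) (fst (snd (snd z))) (snd (snd (snd z))))
         (t - (s + fst z / lmax)) \<omega>))"
        using AE_jump_time_unbounded[OF l]
      proof eventually_elim
        fix \<omega> assume unb: "\<forall>t. \<exists>n. t < jump_time lmax \<omega> n"
        show "?g (case_nat z \<omega>) = (if t - s < fst z / lmax then (if t - s = 0 then f x else f (H x (fst (snd z)) (t - s)))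
        else f (jump_process lmax rate G H (\<lambda>r. \<mu> (s + fst z / lmax + r))
         (post_jump lmax rate G (\<mu> (s + fst z / lmax)) (H x (fst (snd z)) (fst z / lmax)) (fst (snd (snd z))) (snd (snd (snd z))))
         (t - (s + fst z / lmax)) \<omega>))"
          using st by (subst jump_process_case_nat[OF l z(1) _ unb]) (auto simp: \<Phi>_def add.assoc diff_diff_eq)
      qed
    qed (measurable; fail | simp)+
    also have "\<dots> = ?\<Psi> z"
      by (simp add: \<Phi>_def flow_semigroup_def jump_noise.prob_space)
    finally show ?thesis .
  qed
  have "evol \<mu> s t f x = (\<integral>z. \<integral>\<omega>. ?g (case_nat z \<omega>) \<partial>jump_noise \<partial>noise_law)"
    unfolding flow_semigroup_def by (intro integral_jump_noise_shift[where C=1]) (auto simp: f1)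
  also have "\<dots> = (\<integral>z. ?\<Psi> z \<partial>noise_law)"
    using AE_noise_law_pos AE_space by (intro integral_cong_AE) (auto intro: inner elim!: eventually_rev_mp)
  also have "\<dots> = (\<integral>\<sigma>. \<integral>a. ?\<Psi> (\<sigma>, a) \<partial>?UUU \<partial>exp_law 1)"
    by (intro Fubini_prob_bounded(1)[where C=1] prob_space_pair_measure prob_space_unif01 E1.prob_space_axioms)
      (auto simp: \<Phi>1)
  also have "\<dots> = (\<integral>\<sigma>. \<integral>u. \<integral>b. ?\<Psi> (\<sigma>, u, b) \<partial>(unif01 \<Otimes>\<^sub>M unif01) \<partial>unif01 \<partial>exp_law 1)"
    by (intro Bochner_Integration.integral_cong refl Fubini_prob_bounded(1)[where C=1] prob_space_pair_measure prob_space_unif01)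
      (auto simp: \<Phi>1)
  also have "\<dots> = (\<integral>\<sigma>. \<integral>u. \<integral>v. \<integral>w. \<Phi> (\<sigma> / lmax) u v w \<partial>unif01 \<partial>unif01 \<partial>unif01 \<partial>exp_law 1)"
    by (intro Bochner_Integration.integral_cong refl, subst Fubini_prob_bounded(1)[where C=1])
      (auto simp: \<Phi>1 intro: prob_space_unif01)
  also have "\<dots> = (\<integral>\<tau>. \<integral>u. \<integral>v. \<integral>w. \<Phi> \<tau> u v w \<partial>unif01 \<partial>unif01 \<partial>unif01 \<partial>exp_law lmax)"
    by (subst distr_exp_law_scale[OF l, symmetric], subst integral_distr) auto
  also have "\<dots> = (\<integral>\<tau>. (if t - s < \<tau> then heat (t - s) f x
      else heat \<tau> (jump_op (\<mu> (s + \<tau>)) (evol \<mu> (s + \<tau>) t f)) x) \<partial>exp_law lmax)"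
  proof (intro Bochner_Integration.integral_cong refl)
    fix \<tau> :: real
    show "(\<integral>u. \<integral>v. \<integral>w. \<Phi> \<tau> u v w \<partial>unif01 \<partial>unif01 \<partial>unif01) = (if t - s < \<tau> then heat (t - s) f x
      else heat \<tau> (jump_op (\<mu> (s + \<tau>)) (evol \<mu> (s + \<tau>) t f)) x)"
    proof (cases "t - s < \<tau>")
      case True
      then have "(\<integral>u. \<integral>v. \<integral>w. \<Phi> \<tau> u v w \<partial>unif01 \<partial>unif01 \<partial>unif01) = (\<integral>u. (if t - s = 0 then f x else f (H x u (t - s))) \<partial>unif01)"
        by (simp add: \<Phi>_def measure_unif01)
      also have "\<dots> = heat (t - s) f x"
        using heat_zero[OF f_meas, of x] by (cases "t - s = 0") (simp_all add: heat_def measure_unif01)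
      finally show ?thesis using True by simp
    qed (simp add: \<Phi>_def heat_def jump_op_def)
  qed
  finally show ?thesis .
qed

end

section \<open>Uniqueness, flow property and stability\<close>

text \<open>The substitute for Gronwall's lemma: a crude bound with excess \<open>C\<close> improves to the excesses
  \<open>c C\<close>, \<open>c\<^sup>2 C\<close>, and so on.\<close>

lemma le_if_contraction:
  fixes D b :: "'i \<Rightarrow> real"
  assumes c: "0 \<le> c" "c < 1" and C: "0 \<le> C"
    and init: "\<And>i. i \<in> I \<Longrightarrow> D i \<le> b i + C"
    and step: "\<And>M i. 0 \<le> M \<Longrightarrow> (\<And>j. j \<in> I \<Longrightarrow> D j \<le> b j + M) \<Longrightarrow> i \<in> I \<Longrightarrow> D i \<le> b i + c * M"
    and i: "i \<in> I"
  shows "D i \<le> b i"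
proof -
  have "D j \<le> b j + c ^ n * C" if "j \<in> I" for n j
    using that
  proof (induction n arbitrary: j)
    case (Suc n)
    show ?case using step[of "c ^ n * C" j] Suc c C by (simp add: mult.assoc)
  qed (simp add: init)
  moreover have "(\<lambda>n. b i + c ^ n * C) \<longlonglongrightarrow> b i + 0 * C"
    using c by (intro tendsto_intros LIMSEQ_power_zero) auto
  ultimately have "D i \<le> b i + 0 * C"
    using i by (intro LIMSEQ_le_const[of _ "b i + 0 * C"]) auto
  then show ?thesis by simp
qed

text \<open>The integrand times the density \<open>l exp(-l \<tau>)\<close> is the derivative of \<open>- exp(-l \<tau>) b \<tau>\<close>. For
  constant \<open>b\<close> this is the distribution function of the exponential law; in the stability estimate
  \<open>b\<close> is the claimed bound itself, which the integral reproduces exactly.\<close>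

lemma integral_exp_law_upto:
  fixes b b' :: "real \<Rightarrow> real"
  assumes l: "0 < l" and a: "0 \<le> a"
    and b: "\<And>\<tau>. (b has_real_derivative b' \<tau>) (at \<tau>)" and b': "continuous_on UNIV b'"
  shows "(\<integral>\<tau>. (if a < \<tau> then 0 else b \<tau> - b' \<tau> / l) \<partial>exp_law l) = b 0 - exp (- l * a) * b a"
proof -
  have b_cont: "continuous_on UNIV b"
    using b by (auto intro!: continuous_at_imp_continuous_on DERIV_isCont)
  have [measurable]: "b \<in> borel_measurable borel" "b' \<in> borel_measurable borel"
    using b_cont b' by (auto intro: borel_measurable_continuous_onI)
  have "(\<integral>\<tau>. (if a < \<tau> then 0 else b \<tau> - b' \<tau> / l) \<partial>exp_law l)
      = (\<integral>\<tau>. exponential_density l \<tau> * (if a < \<tau> then 0 else b \<tau> - b' \<tau> / l) \<partial>lborel)"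
    using l by (intro integral_real_density) (auto simp: exponential_density_nonneg)
  also have "\<dots> = (\<integral>\<tau>. exp (- l * \<tau>) * (l * b \<tau> - b' \<tau>) * indicator {0..a} \<tau> \<partial>lborel)"
    using l by (intro Bochner_Integration.integral_cong refl)
      (auto simp: exponential_density_def field_simps split: split_indicator)
  also have "\<dots> = - exp (- l * a) * b a - (- exp (- l * 0) * b 0)"
  proof (rule integral_FTC_Icc_real[OF a])
    fix \<tau>
    show "((\<lambda>\<tau>. - exp (- l * \<tau>) * b \<tau>) has_real_derivative exp (- l * \<tau>) * (l * b \<tau> - b' \<tau>)) (at \<tau>)"
      by (auto intro!: derivative_eq_intros b simp: algebra_simps)
    show "isCont (\<lambda>\<tau>. exp (- l * \<tau>) * (l * b \<tau> - b' \<tau>)) \<tau>"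
      using b_cont b' by (intro continuous_intros) (auto simp: continuous_on_eq_continuous_at)
  qed
  finally show ?thesis by simp
qed

text \<open>On the event that the clock has not rung by time \<open>c\<close>, an expectation may be replaced by its
  conditional value, for which the clock is restarted at \<open>c\<close>.\<close>

lemma exp_law_memoryless:
  fixes g :: "real \<Rightarrow> real"
  assumes l: "0 < l" and c: "0 \<le> c"
    and g[measurable]: "g \<in> borel_measurable borel" and C: "\<And>\<tau>. \<bar>g \<tau>\<bar> \<le> C"
  shows "(\<integral>\<tau>. (if c < \<tau> then (\<integral>\<tau>'. g (c + \<tau>') \<partial>exp_law l) else g \<tau>) \<partial>exp_law l) = (\<integral>\<tau>. g \<tau> \<partial>exp_law l)"
proof -
  interpret prob_space "exp_law l" by (rule prob_space_exp_law[OF l])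
  define A where "A = (\<integral>\<tau>'. g (c + \<tau>') \<partial>exp_law l)"
  have tail: "(\<integral>\<tau>. (if c < \<tau> then f \<tau> else 0) \<partial>exp_law l) = exp (- l * c) * (\<integral>\<tau>. f (c + \<tau>) \<partial>exp_law l)"
    if [measurable]: "f \<in> borel_measurable borel" for f :: "real \<Rightarrow> real"
  proof -
    have "(\<integral>\<tau>. (if c < \<tau> then f \<tau> else 0) \<partial>exp_law l)
        = (\<integral>\<tau>. exponential_density l \<tau> * (if c < \<tau> then f \<tau> else 0) \<partial>lborel)"
      using l by (intro integral_real_density) (auto simp: exponential_density_nonneg)
    also have "\<dots> = (\<integral>\<tau>. exponential_density l (c + \<tau>) * (if c < c + \<tau> then f (c + \<tau>) else 0) \<partial>lborel)"
      by (subst lborel_integral_real_affine[where c=1 and t=c]) (simp_all cong: if_cong)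
    also have "\<dots> = (\<integral>\<tau>. exp (- l * c) * (exponential_density l \<tau> * f (c + \<tau>)) \<partial>lborel)"
    proof (rule integral_cong_AE)
      show "AE \<tau> in lborel. exponential_density l (c + \<tau>) * (if c < c + \<tau> then f (c + \<tau>) else 0)
          = exp (- l * c) * (exponential_density l \<tau> * f (c + \<tau>))"
        using AE_lborel_singleton[of "0::real"]
        by eventually_elim (use c in \<open>auto simp: exponential_density_def exp_add[symmetric] algebra_simps\<close>)
    qed auto
    also have "\<dots> = exp (- l * c) * (\<integral>\<tau>. f (c + \<tau>) \<partial>exp_law l)"
      using l by (subst integral_real_density) (auto simp: exponential_density_nonneg)
    finally show ?thesis .
  qed
  have A: "\<bar>A\<bar> \<le> max 0 C" unfolding A_def using C by (intro abs_integral_le_bound) (auto simp: le_max_iff_disj)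
  have int: "integrable (exp_law l) (\<lambda>\<tau>. if c < \<tau> then A else 0)"
    "integrable (exp_law l) (\<lambda>\<tau>. if c < \<tau> then g \<tau> else 0)"
    "integrable (exp_law l) (\<lambda>\<tau>. if c < \<tau> then 0 else g \<tau>)"
    using C A by (auto intro!: integrable_bounded[where C="max 0 C"] simp: le_max_iff_disj)
  have "(\<integral>\<tau>. (if c < \<tau> then A else g \<tau>) \<partial>exp_law l)
      = (\<integral>\<tau>. (if c < \<tau> then A else 0) + (if c < \<tau> then 0 else g \<tau>) \<partial>exp_law l)"
    by (intro Bochner_Integration.integral_cong) auto
  also have "\<dots> = exp (- l * c) * A + (\<integral>\<tau>. (if c < \<tau> then 0 else g \<tau>) \<partial>exp_law l)"
    using int by (simp add: tail prob_space[simplified])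
  also have "exp (- l * c) * A = (\<integral>\<tau>. (if c < \<tau> then g \<tau> else 0) \<partial>exp_law l)"
    by (simp add: tail A_def)
  also have "\<dots> + (\<integral>\<tau>. (if c < \<tau> then 0 else g \<tau>) \<partial>exp_law l)
      = (\<integral>\<tau>. (if c < \<tau> then g \<tau> else 0) + (if c < \<tau> then 0 else g \<tau>) \<partial>exp_law l)"
    using int by simp
  also have "\<dots> = (\<integral>\<tau>. g \<tau> \<partial>exp_law l)"
    by (intro Bochner_Integration.integral_cong) auto
  finally show ?thesis by (simp only: A_def)
qed

lemma (in prob_space) abs_integral_diff_le:
  fixes f g :: "'a \<Rightarrow> real"
  assumes "f \<in> borel_measurable M" "g \<in> borel_measurable M"
    and B: "\<And>x. \<bar>f x\<bar> \<le> B" "\<And>x. \<bar>g x\<bar> \<le> B" and C: "\<And>x. \<bar>f x - g x\<bar> \<le> C"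
  shows "\<bar>(\<integral>x. f x \<partial>M) - (\<integral>x. g x \<partial>M)\<bar> \<le> C"
proof -
  have "integrable M f" "integrable M g" using assms by (auto intro: integrable_bounded)
  then have "(\<integral>x. f x \<partial>M) - (\<integral>x. g x \<partial>M) = (\<integral>x. f x - g x \<partial>M)" by simp
  moreover have "0 \<le> C" using C[of undefined] by simp
  ultimately show ?thesis using C abs_integral_le_bound[of C "\<lambda>x. f x - g x"] by simp
qed

context jump_model begin

lemma heat_diff_le:
  assumes [measurable]: "f \<in> borel_measurable borel" "g \<in> borel_measurable borel"
    and "\<And>x. \<bar>f x\<bar> \<le> B" "\<And>x. \<bar>g x\<bar> \<le> B" "\<And>x. \<bar>f x - g x\<bar> \<le> C"
  shows "\<bar>heat t f x - heat t g x\<bar> \<le> C"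
  unfolding heat_def
proof (rule unif01.abs_integral_diff_le[where B=B])
  show "(\<lambda>u. f (H x u t)) \<in> borel_measurable unif01" "(\<lambda>u. g (H x u t)) \<in> borel_measurable unif01"
    by measurable
qed (rule assms(3-))+

lemma jump_op_diff_le:
  assumes [measurable]: "f \<in> borel_measurable borel" "g \<in> borel_measurable borel"
    and \<nu>: "\<nu> \<in> prob_measures"
    and B: "\<And>x. \<bar>f x\<bar> \<le> B" "\<And>x. \<bar>g x\<bar> \<le> B" and C: "\<And>x. \<bar>f x - g x\<bar> \<le> C"
  shows "\<bar>jump_op \<nu> f y - jump_op \<nu> g y\<bar> \<le> C"
proof -
  have [measurable]: "(\<lambda>_. \<nu>) \<in> M \<rightarrow>\<^sub>M prob_algebra borel" for M :: "'z measure"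
    using \<nu> by (rule measurable_const)
  have "0 \<le> B" using B(1)[of undefined] by simp
  have post: "\<bar>(\<integral>w. f (post_jump lmax rate G \<nu> y v w) \<partial>unif01) - (\<integral>w. g (post_jump lmax rate G \<nu> y v w) \<partial>unif01)\<bar> \<le> C" for v
  proof -
    have pj: "(\<lambda>w. post_jump lmax rate G \<nu> y v w) \<in> unif01 \<rightarrow>\<^sub>M borel"
      unfolding post_jump_def by measurable
    show ?thesis
      by (rule unif01.abs_integral_diff_le[where B=B, OF measurable_compose[OF pj assms(1)] measurable_compose[OF pj assms(2)]])
        (rule B C)+
  qed
  show ?thesis
    unfolding jump_op_def
  proof (rule unif01.abs_integral_diff_le[where B=B, OF _ _ _ _ post])
    show "\<bar>\<integral>w. f (post_jump lmax rate G \<nu> y v w) \<partial>unif01\<bar> \<le> B" for v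
      by (intro unif01.abs_integral_le_bound B(1) \<open>0 \<le> B\<close>)
    show "\<bar>\<integral>w. g (post_jump lmax rate G \<nu> y v w) \<partial>unif01\<bar> \<le> B" for v
      by (intro unif01.abs_integral_le_bound B(2) \<open>0 \<le> B\<close>)
  qed measurable
qed

lemma heat_add:
  assumes f[measurable]: "f \<in> borel_measurable borel" and B: "\<And>x. \<bar>f x\<bar> \<le> B"
    and st: "0 \<le> s" "0 \<le> t"
  shows "heat (s + t) f x = heat s (heat t f) x"
proof -
  have Pp: "prob_space (P s x)" "sets (P s x) = sets borel"
    using measurable_space[OF P_kernel[OF st(1)], of x] by (auto simp: space_prob_algebra)
  have "heat (s + t) f x = (\<integral>y. f y \<partial>(P s x \<bind> P t))"
    using st by (simp add: integral_P_eq_heat[symmetric] P_semigroup)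
  also have "\<dots> = (\<integral>y. \<integral>z. f z \<partial>P t y \<partial>P s x)"
  proof (rule integral_bind[where K=borel and B=B and B'=1])
    show "P t \<in> P s x \<rightarrow>\<^sub>M subprob_algebra borel"
      using measurable_prob_algebraD[OF P_kernel[OF st(2)]] Pp(2) by (simp cong: measurable_cong_sets)
    show "finite_measure (P s x)" using Pp(1) by (rule prob_space.finite_measure)
    show "AE y in P s x. emeasure (P t y) (space (P t y)) \<le> ennreal 1"
      using measurable_space[OF P_kernel[OF st(2)]]
      by (intro AE_I2) (auto simp: space_prob_algebra prob_space.emeasure_space_1)
  qed (auto simp: B)
  also have "\<dots> = heat s (heat t f) x"
    using st by (simp add: integral_P_eq_heat)
  finally show ?thesis .
qed

lemma evol_refl:
  assumes \<mu>: "\<mu> \<in> borel \<rightarrow>\<^sub>M prob_algebra borel" and f: "f \<in> measurable_unit_ball"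
  shows "evol \<mu> t t f x = f x"
proof -
  have "evol \<mu> t t f x = (\<integral>\<tau>. f x \<partial>exp_law lmax)"
  proof (subst evol_first_jump[OF \<mu> f order_refl], rule integral_cong_AE)
    note [measurable] = \<mu> unit_ballD(1)[OF f]
    show "AE \<tau> in exp_law lmax. (if t - t < \<tau> then heat (t - t) f x
        else heat \<tau> (jump_op (\<mu> (t + \<tau>)) (evol \<mu> (t + \<tau>) t f)) x) = f x"
      using AE_exp_law_pos by eventually_elim (simp add: heat_zero unit_ballD(1)[OF f])
    show "(\<lambda>\<tau>. if t - t < \<tau> then heat (t - t) f x
        else heat \<tau> (jump_op (\<mu> (t + \<tau>)) (evol \<mu> (t + \<tau>) t f)) x) \<in> borel_measurable (exp_law lmax)"
      by measurable
  qed auto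
  then show ?thesis using clock.prob_space by simp
qed

text \<open>The first-ring equation on the shorter interval \<open>[s,a]\<close>, with terminal value \<open>r(a,t) f\<close> at \<open>a\<close>.
  If the clock is silent up to \<open>a\<close>, memorylessness restarts it there, and the semigroup property of
  the free process turns motion up to a ring after \<open>a\<close> into motion up to \<open>a\<close> followed by motion
  from \<open>a\<close> to the ring.\<close>

lemma evol_restart:
  assumes \<mu>[measurable]: "\<mu> \<in> borel \<rightarrow>\<^sub>M prob_algebra borel"
    and f: "f \<in> measurable_unit_ball" and sat: "s \<le> a" "a \<le> t"
  shows "evol \<mu> s t f x = (\<integral>\<tau>. (if a - s < \<tau> then heat (a - s) (evol \<mu> a t f) x
      else heat \<tau> (jump_op (\<mu> (s + \<tau>)) (evol \<mu> (s + \<tau>) t f)) x) \<partial>exp_law lmax)"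
proof -
  note f_meas[measurable] = unit_ballD(1)[OF f] and f1 = unit_ballD(2)[OF f]
  define \<Theta> where "\<Theta> r \<tau> y = (if t - r < \<tau> then heat (t - r) f y
      else heat \<tau> (jump_op (\<mu> (r + \<tau>)) (evol \<mu> (r + \<tau>) t f)) y)" for r \<tau> y
  have \<Theta>1: "\<bar>\<Theta> r \<tau> y\<bar> \<le> 1" for r \<tau> y
    unfolding \<Theta>_def by (auto intro!: abs_heat_le abs_jump_op_le abs_evol_le f1)
  have \<Theta>_meas[measurable (raw)]: "(\<lambda>z. \<Theta> r (\<tau> z) (y z)) \<in> borel_measurable M"
    if [measurable]: "\<tau> \<in> borel_measurable M" "y \<in> borel_measurable M" for M :: "'z measure" and r \<tau> y
    unfolding \<Theta>_def by measurable
  have fj: "evol \<mu> r t f y = (\<integral>\<tau>. \<Theta> r \<tau> y \<partial>exp_law lmax)" if "r \<le> t" for r y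
    unfolding \<Theta>_def by (rule evol_first_jump[OF \<mu> f that])
  \<comment> \<open>Free motion for the time \<open>a - s\<close>, followed by a waiting time \<open>\<tau>\<close> from \<open>a\<close>, is a waiting time \<open>a - s + \<tau>\<close> from \<open>s\<close>.\<close>
  have heat_\<Theta>: "heat (a - s) (\<Theta> a \<tau>) x = \<Theta> s (a - s + \<tau>) x" if \<tau>: "0 < \<tau>" for \<tau>
  proof (cases "t - a < \<tau>")
    case True
    then have "\<Theta> a \<tau> = heat (t - a) f" by (auto simp: \<Theta>_def)
    then show ?thesis using True sat heat_add[OF f_meas f1, of "a - s" "t - a" x] by (simp add: \<Theta>_def)
  next
    case False
    let ?g = "jump_op (\<mu> (a + \<tau>)) (evol \<mu> (a + \<tau>) t f)"
    have "\<Theta> a \<tau> = heat \<tau> ?g" using False by (auto simp: \<Theta>_def)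
    moreover have "heat (a - s + \<tau>) ?g x = heat (a - s) (heat \<tau> ?g) x"
      using sat \<tau> by (intro heat_add[where B=1] abs_jump_op_le abs_evol_le f1) auto
    ultimately show ?thesis using False by (simp add: \<Theta>_def)
  qed
  have "heat (a - s) (evol \<mu> a t f) x = (\<integral>u. \<integral>\<tau>. \<Theta> a \<tau> (H x u (a - s)) \<partial>exp_law lmax \<partial>unif01)"
    using sat by (simp add: heat_def fj)
  also have "\<dots> = (\<integral>\<tau>. \<integral>u. \<Theta> a \<tau> (H x u (a - s)) \<partial>unif01 \<partial>exp_law lmax)"
    using Fubini_prob_bounded(2)[OF prob_space_unif01 clock.prob_space_axioms,
        of "\<lambda>(u, \<tau>). \<Theta> a \<tau> (H x u (a - s))" 1] by (simp add: \<Theta>1 split_beta)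
  also have "\<dots> = (\<integral>\<tau>. \<Theta> s (a - s + \<tau>) x \<partial>exp_law lmax)"
  proof (rule integral_cong_AE)
    show "AE \<tau> in exp_law lmax. (\<integral>u. \<Theta> a \<tau> (H x u (a - s)) \<partial>unif01) = \<Theta> s (a - s + \<tau>) x"
      using AE_exp_law_pos by eventually_elim (use heat_\<Theta> in \<open>simp add: heat_def\<close>)
  qed auto
  finally have shift: "heat (a - s) (evol \<mu> a t f) x = (\<integral>\<tau>. \<Theta> s (a - s + \<tau>) x \<partial>exp_law lmax)" .
  have "evol \<mu> s t f x = (\<integral>\<tau>. (if a - s < \<tau> then heat (a - s) (evol \<mu> a t f) x else \<Theta> s \<tau> x) \<partial>exp_law lmax)"
    unfolding shift using sat
    by (subst exp_law_memoryless[OF lmax_pos, where C=1]) (auto simp: \<Theta>1 fj)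
  also have "\<dots> = (\<integral>\<tau>. (if a - s < \<tau> then heat (a - s) (evol \<mu> a t f) x
      else heat \<tau> (jump_op (\<mu> (s + \<tau>)) (evol \<mu> (s + \<tau>) t f)) x) \<partial>exp_law lmax)"
    using sat by (intro Bochner_Integration.integral_cong refl) (auto simp: \<Theta>_def)
  finally show ?thesis .
qed

text \<open>The right-hand side \<open>b s\<close> is the integral of \<open>\<kappa> exp(\<eta> u)\<close> over \<open>[s,t]\<close>. A bound \<open>b + M\<close> for the
  difference of the two evolutions at all later starting times, inserted into the first-ring equation,
  gives the bound \<open>E [ 1_{\<tau> \<le> t-s} (\<kappa>/lmax exp(\<eta>(s+\<tau>)) + b(s+\<tau>) + M) ]\<close>. As
  \<open>b' = - \<kappa> exp(\<eta> u)\<close>, this equals \<open>b s + (1 - exp(-lmax (t-s))) M\<close>.\<close>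

lemma evol_diff_le:
  assumes \<mu>[measurable]: "\<mu> \<in> borel \<rightarrow>\<^sub>M prob_algebra borel" and \<nu>[measurable]: "\<nu> \<in> borel \<rightarrow>\<^sub>M prob_algebra borel"
    and f: "f \<in> measurable_unit_ball" 
    and \<kappa>: "0 \<le> \<kappa>" and \<eta>: "0 < \<eta>"
    and close: "\<And>u y \<phi>. s0 \<le> u \<Longrightarrow> u \<le> t \<Longrightarrow> \<phi> \<in> measurable_unit_ball \<Longrightarrow>
      \<bar>jump_op (\<mu> u) \<phi> y - jump_op (\<nu> u) \<phi> y\<bar> \<le> \<kappa> / lmax * exp (\<eta> * u)"
    and st: "s0 \<le> s" "s \<le> t"
  shows "\<bar>evol \<mu> s t f x - evol \<nu> s t f x\<bar> \<le> \<kappa> / \<eta> * (exp (\<eta> * t) - exp (\<eta> * s))"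
proof -
  note f_meas[measurable] = unit_ballD(1)[OF f] and f1 = unit_ballD(2)[OF f]
  define D where "D = (\<lambda>(s, x). \<bar>evol \<mu> s t f x - evol \<nu> s t f x\<bar>)"
  define b where "b s = \<kappa> / \<eta> * (exp (\<eta> * t) - exp (\<eta> * s))" for s
  let ?c = "1 - exp (- lmax * (t - s0))"
  have [measurable]: "b \<in> borel_measurable borel"
    unfolding b_def by measurable
  have b0: "0 \<le> b s" if "s \<le> t" for s
    unfolding b_def using \<kappa> \<eta> that by (intro mult_nonneg_nonneg) auto
  have p: "\<mu> u \<in> prob_measures" "\<nu> u \<in> prob_measures" for u
    using measurable_space[OF \<mu>] measurable_space[OF \<nu>] by auto
  have D2: "D (s, x) \<le> 2" for s x
    using abs_evol_le[of 1 f \<mu> s t x] abs_evol_le[of 1 f \<nu> s t x] by (simp add: D_def f1)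
  have step: "D (s, x) \<le> b s + ?c * M"
    if M: "0 \<le> M" and IH: "\<And>u y. s0 \<le> u \<Longrightarrow> u \<le> t \<Longrightarrow> D (u, y) \<le> b u + M" and s: "s0 \<le> s" "s \<le> t" for M s x
  proof -
    let ?h = "\<lambda>\<mu> \<tau>. heat \<tau> (jump_op (\<mu> (s + \<tau>)) (evol \<mu> (s + \<tau>) t f)) x"
    let ?F = "\<lambda>\<mu> \<tau>. if t - s < \<tau> then heat (t - s) f x else ?h \<mu> \<tau>"
    let ?B = "\<lambda>\<tau>. if t - s < \<tau> then 0 else (b (s + \<tau>) + M) - (- \<kappa> * exp (\<eta> * (s + \<tau>))) / lmax"
    have h1: "\<bar>?h m \<tau>\<bar> \<le> 1" for m \<tau>
      by (intro abs_heat_le abs_jump_op_le abs_evol_le f1) auto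
    have F1: "\<bar>?F m \<tau>\<bar> \<le> 1" for m \<tau>
      using h1 by (auto intro!: abs_heat_le f1)
    have Fint: "integrable (exp_law lmax) (?F \<mu>)" "integrable (exp_law lmax) (?F \<nu>)"
      by (rule clock.integrable_bounded[OF _ F1], measurable)+
    have hdiff: "\<bar>?h \<mu> \<tau> - ?h \<nu> \<tau>\<bar> \<le> ?B \<tau>" if \<tau>: "0 < \<tau>" "\<tau> \<le> t - s" for \<tau>
    proof -
      let ?u = "s + \<tau>"
      have u: "s0 \<le> ?u" "?u \<le> t" using \<tau> s by auto
      have "\<bar>jump_op (\<mu> ?u) (evol \<mu> ?u t f) y - jump_op (\<nu> ?u) (evol \<nu> ?u t f) y\<bar> \<le> ?B \<tau>" for y
      proof -
        have "\<bar>jump_op (\<mu> ?u) (evol \<mu> ?u t f) y - jump_op (\<nu> ?u) (evol \<mu> ?u t f) y\<bar> \<le> \<kappa> / lmax * exp (\<eta> * ?u)"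
          by (intro close u evol_unit_ball \<mu> f)
        moreover have "\<bar>jump_op (\<nu> ?u) (evol \<mu> ?u t f) y - jump_op (\<nu> ?u) (evol \<nu> ?u t f) y\<bar> \<le> b ?u + M"
          using IH[OF u] by (intro jump_op_diff_le[where B=1] p abs_evol_le f1) (auto simp: D_def)
        ultimately show ?thesis using \<tau> by simp
      qed
      then show ?thesis by (intro heat_diff_le[where B=1] abs_jump_op_le abs_evol_le f1) auto
    qed
    have Bint: "integrable (exp_law lmax) ?B"
    proof (rule clock.integrable_bounded)
      have "b (s + \<tau>) \<le> b s" if "0 < \<tau>" for \<tau>
        using that \<kappa> \<eta> unfolding b_def by (intro mult_left_mono) auto
      show "\<bar>?B \<tau>\<bar> \<le> \<kappa> / \<eta> * exp (\<eta> * t) + M + \<kappa> * exp (\<eta> * t) / lmax" for \<tau>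
      proof (cases "t - s < \<tau>")
        case False
        have e: "exp (\<eta> * (s + \<tau>)) \<le> exp (\<eta> * t)" using False \<eta> by simp
        have "0 \<le> b (s + \<tau>)" using False by (intro b0) simp
        moreover have "b (s + \<tau>) \<le> \<kappa> / \<eta> * exp (\<eta> * t)"
          unfolding b_def using \<kappa> \<eta> by (intro mult_left_mono) auto
        moreover have "\<kappa> * exp (\<eta> * (s + \<tau>)) / lmax \<le> \<kappa> * exp (\<eta> * t) / lmax"
          using \<kappa> lmax_pos e by (intro divide_right_mono mult_left_mono) auto
        moreover have "0 \<le> \<kappa> * exp (\<eta> * (s + \<tau>)) / lmax"
          using \<kappa> lmax_pos by simp
        ultimately show ?thesis using M False by simp
      qed (use \<kappa> \<eta> M lmax_pos in simp)
    qed measurable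
    have "evol \<mu> s t f x - evol \<nu> s t f x = (\<integral>\<tau>. ?F \<mu> \<tau> - ?F \<nu> \<tau> \<partial>exp_law lmax)"
      using Fint by (simp add: evol_first_jump[OF \<mu> f s(2)] evol_first_jump[OF \<nu> f s(2)])
    then have "D (s, x) \<le> (\<integral>\<tau>. \<bar>?F \<mu> \<tau> - ?F \<nu> \<tau>\<bar> \<partial>exp_law lmax)"
      by (simp add: D_def integral_abs_bound)
    also have "\<dots> \<le> (\<integral>\<tau>. ?B \<tau> \<partial>exp_law lmax)"
    proof (rule integral_mono_AE[OF _ Bint])
      show "integrable (exp_law lmax) (\<lambda>\<tau>. \<bar>?F \<mu> \<tau> - ?F \<nu> \<tau>\<bar>)" using Fint by simp
      show "AE \<tau> in exp_law lmax. \<bar>?F \<mu> \<tau> - ?F \<nu> \<tau>\<bar> \<le> ?B \<tau>"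
        using AE_exp_law_pos
      proof eventually_elim
        fix \<tau> :: real assume "0 < \<tau>"
        then show "\<bar>?F \<mu> \<tau> - ?F \<nu> \<tau>\<bar> \<le> ?B \<tau>"
          using hdiff[of \<tau>] by (cases "t - s < \<tau>") auto
      qed
    qed
    also have "\<dots> = (b (s + 0) + M) - exp (- lmax * (t - s)) * (b (s + (t - s)) + M)"
    proof (rule integral_exp_law_upto[OF lmax_pos])
      show "((\<lambda>\<tau>. b (s + \<tau>) + M) has_real_derivative - \<kappa> * exp (\<eta> * (s + \<tau>))) (at \<tau>)" for \<tau>
        unfolding b_def using \<eta> by (auto intro!: derivative_eq_intros)
      show "continuous_on UNIV (\<lambda>\<tau>. - \<kappa> * exp (\<eta> * (s + \<tau>)))"
        by (intro continuous_intros)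
    qed (use s in simp)
    also have "\<dots> = b s + (1 - exp (- lmax * (t - s))) * M"
      by (simp add: b_def algebra_simps)
    also have "\<dots> \<le> b s + ?c * M"
      using M s lmax_pos by (intro add_left_mono mult_right_mono) auto
    finally show ?thesis .
  qed
  have "D (s, x) \<le> b (fst (s, x))"
  proof (rule le_if_contraction[where c="?c" and C=2 and I="{s0..t} \<times> UNIV"])
    show "0 \<le> ?c" "?c < 1" using st lmax_pos by auto
    show "D i \<le> b (fst i) + 2" if "i \<in> {s0..t} \<times> UNIV" for i
      using D2[of "fst i" "snd i"] b0[of "fst i"] that by auto
    show "D i \<le> b (fst i) + ?c * M"
      if "0 \<le> M" "\<And>j. j \<in> {s0..t} \<times> UNIV \<Longrightarrow> D j \<le> b (fst j) + M" "i \<in> {s0..t} \<times> UNIV" for M i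
      using step[OF that(1), of "fst i" "snd i"] that(2)[of "(_, _)"] that(3) by (cases i) auto
  qed (use st in auto)
  then show ?thesis by (simp add: D_def b_def)
qed

text \<open>Both sides satisfy the first-ring equation on \<open>[s,a]\<close> with the same terminal value, and a bound
  \<open>M\<close> for their difference improves to \<open>(1 - exp(-lmax (a-s))) M\<close>.\<close>

theorem evol_evol:
  assumes \<mu>[measurable]: "\<mu> \<in> borel \<rightarrow>\<^sub>M prob_algebra borel"
    and f: "f \<in> measurable_unit_ball" and sat: "s \<le> a" "a \<le> t"
  shows "evol \<mu> s t f x = evol \<mu> s a (evol \<mu> a t f) x"
proof -
  note f_meas[measurable] = unit_ballD(1)[OF f] and f1 = unit_ballD(2)[OF f]
  let ?g = "evol \<mu> a t f"
  have g: "?g \<in> measurable_unit_ball" by (rule evol_unit_ball[OF \<mu> f])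
  note g_meas[measurable] = unit_ballD(1)[OF g] and g1 = unit_ballD(2)[OF g]
  define D where "D = (\<lambda>(s, x). \<bar>evol \<mu> s t f x - evol \<mu> s a ?g x\<bar>)"
  have p: "\<mu> u \<in> prob_measures" for u
    using measurable_space[OF \<mu>] by auto
  let ?c = "1 - exp (- lmax * (a - s))"
  have D2: "D (r, x) \<le> 2" for r x
    using abs_evol_le[of 1 f \<mu> r t x] abs_evol_le[of 1 ?g \<mu> r a x] by (simp add: D_def f1 g1)
  have step: "D (r, x) \<le> ?c * M"
    if M: "0 \<le> M" and IH: "\<And>u y. s \<le> u \<Longrightarrow> u \<le> a \<Longrightarrow> D (u, y) \<le> M" and r: "s \<le> r" "r \<le> a" for M r x
  proof -
    let ?F = "\<lambda>t f \<tau>. if a - r < \<tau> then heat (a - r) ?g x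
      else heat \<tau> (jump_op (\<mu> (r + \<tau>)) (evol \<mu> (r + \<tau>) t f)) x"
    \<comment> \<open>The summand \<open>0 / lmax\<close> is the derivative term of \<open>integral_exp_law_upto\<close> for a constant function.\<close>
    let ?B = "\<lambda>\<tau>. if a - r < \<tau> then 0 else M - 0 / lmax"
    have Fint: "integrable (exp_law lmax) (?F t f)" "integrable (exp_law lmax) (?F a ?g)"
      by (rule clock.integrable_bounded[where C=1], measurable,
          auto intro!: abs_heat_le abs_jump_op_le abs_evol_le f1 g1)+
    have Bint: "integrable (exp_law lmax) ?B"
      using M by (intro clock.integrable_bounded[where C=M]) auto
    have "evol \<mu> r t f x - evol \<mu> r a ?g x = (\<integral>\<tau>. ?F t f \<tau> - ?F a ?g \<tau> \<partial>exp_law lmax)"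
      using Fint by (simp add: evol_restart[OF \<mu> f r(2) sat(2)] evol_first_jump[OF \<mu> g r(2)])
    then have "D (r, x) \<le> (\<integral>\<tau>. \<bar>?F t f \<tau> - ?F a ?g \<tau>\<bar> \<partial>exp_law lmax)"
      by (simp add: D_def integral_abs_bound)
    also have "\<dots> \<le> (\<integral>\<tau>. ?B \<tau> \<partial>exp_law lmax)"
    proof (rule integral_mono_AE[OF _ Bint])
      show "integrable (exp_law lmax) (\<lambda>\<tau>. \<bar>?F t f \<tau> - ?F a ?g \<tau>\<bar>)" using Fint by simp
      show "AE \<tau> in exp_law lmax. \<bar>?F t f \<tau> - ?F a ?g \<tau>\<bar> \<le> ?B \<tau>"
        using AE_exp_law_pos
      proof eventually_elim
        fix \<tau> :: real assume \<tau>: "0 < \<tau>"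
        show "\<bar>?F t f \<tau> - ?F a ?g \<tau>\<bar> \<le> ?B \<tau>"
        proof (cases "a - r < \<tau>")
          case False
          have "\<bar>evol \<mu> (r + \<tau>) t f y - evol \<mu> (r + \<tau>) a ?g y\<bar> \<le> M" for y
            using IH[of "r + \<tau>" y] \<tau> r False by (simp add: D_def)
          then have "\<bar>heat \<tau> (jump_op (\<mu> (r + \<tau>)) (evol \<mu> (r + \<tau>) t f)) x
              - heat \<tau> (jump_op (\<mu> (r + \<tau>)) (evol \<mu> (r + \<tau>) a ?g)) x\<bar> \<le> M"
            by (intro heat_diff_le[where B=1] jump_op_diff_le[where B=1] abs_jump_op_le abs_evol_le f1 g1 p) auto
          then show ?thesis using False by simp
        qed simp
      qed
    qed
    also have "\<dots> = M - exp (- lmax * (a - r)) * M"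
      using r by (intro integral_exp_law_upto[OF lmax_pos]) (auto intro!: derivative_eq_intros)
    also have "\<dots> = (1 - exp (- lmax * (a - r))) * M"
      by (simp add: algebra_simps)
    also have "\<dots> \<le> ?c * M"
      using M r lmax_pos by (intro mult_right_mono) auto
    finally show ?thesis .
  qed
  have "D (s, x) \<le> 0"
  proof (rule le_if_contraction[where c="?c" and C=2 and I="{s..a} \<times> UNIV" and b="\<lambda>_. 0"])
    show "0 \<le> ?c" "?c < 1" using sat lmax_pos by auto
    show "D i \<le> 0 + 2" for i using D2[of "fst i" "snd i"] by simp
    show "D i \<le> 0 + ?c * M"
      if "0 \<le> M" "\<And>j. j \<in> {s..a} \<times> UNIV \<Longrightarrow> D j \<le> 0 + M" "i \<in> {s..a} \<times> UNIV" for M i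
      using step[OF that(1), of "fst i" "snd i"] that(2)[of "(_, _)"] that(3) by (cases i) auto
  qed (use sat in auto)
  then show ?thesis by (simp add: D_def)
qed

end

section \<open>Total variation estimates\<close>

lemma prob_measuresD:
  assumes "\<nu> \<in> prob_measures"
  shows "prob_space \<nu>" "sets \<nu> = sets borel"
  using assms by (auto simp: space_prob_algebra)

lemma integrable_prob_measure:
  fixes f :: "'e::topological_space \<Rightarrow> real"
  assumes "\<nu> \<in> prob_measures" "f \<in> borel_measurable borel" "\<And>x. \<bar>f x\<bar> \<le> B"
  shows "integrable \<nu> f"
  using prob_measuresD[OF assms(1)] assms(2,3)
  by (intro prob_space.integrable_bounded[where C=B]) (auto cong: measurable_cong_sets)

lemma
  assumes \<nu>: "\<nu>1 \<in> prob_measures" "\<nu>2 \<in> prob_measures"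
  shows integral_diff_le_tv_norm: "f \<in> measurable_unit_ball \<Longrightarrow> (\<integral>x. f x \<partial>\<nu>1) - (\<integral>x. f x \<partial>\<nu>2) \<le> tv_norm \<nu>1 \<nu>2"
    and tv_norm_le_iff: "tv_norm \<nu>1 \<nu>2 \<le> c \<longleftrightarrow> (\<forall>f\<in>measurable_unit_ball. (\<integral>x. f x \<partial>\<nu>1) - (\<integral>x. f x \<partial>\<nu>2) \<le> c)"
    and tv_norm_nonneg: "0 \<le> tv_norm \<nu>1 \<nu>2"
    and tv_norm_le_2: "tv_norm \<nu>1 \<nu>2 \<le> 2"
proof -
  let ?d = "\<lambda>f. (\<integral>x. f x \<partial>\<nu>1) - (\<integral>x. f x \<partial>\<nu>2)"
  have le2: "?d f \<le> 2" if "f \<in> measurable_unit_ball" for f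
    using prob_space.abs_integral_le_bound[OF prob_measuresD(1)[OF \<nu>(1)], of 1 f]
      prob_space.abs_integral_le_bound[OF prob_measuresD(1)[OF \<nu>(2)], of 1 f] unit_ballD(2)[OF that]
    by auto
  have bdd: "bdd_above (?d ` measurable_unit_ball)"
    using le2 by (intro bdd_aboveI2)
  have zero: "(\<lambda>_. 0) \<in> measurable_unit_ball" by (simp add: measurable_unit_ball_def)
  then have ne: "measurable_unit_ball \<noteq> {}" by blast
  show *: "?d f \<le> tv_norm \<nu>1 \<nu>2" if "f \<in> measurable_unit_ball" for f
    unfolding tv_norm_def by (rule cSUP_upper[OF that bdd])
  show iff: "tv_norm \<nu>1 \<nu>2 \<le> c \<longleftrightarrow> (\<forall>f\<in>measurable_unit_ball. ?d f \<le> c)" for c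
    unfolding tv_norm_def by (rule cSUP_le_iff[OF ne bdd])
  show "0 \<le> tv_norm \<nu>1 \<nu>2" using *[OF zero] by simp
  show "tv_norm \<nu>1 \<nu>2 \<le> 2" using le2 by (simp add: iff)
qed

text \<open>Subtracting from \<open>g\<close> the midpoint of its range leaves the difference of the integrals unchanged and
  makes the function bounded by \<open>c\<close>.\<close>

lemma integral_diff_le_oscillation:
  fixes g :: "'e::topological_space \<Rightarrow> real"
  assumes \<nu>: "\<nu>1 \<in> prob_measures" "\<nu>2 \<in> prob_measures"
    and g: "g \<in> borel_measurable borel" and B: "\<And>x. \<bar>g x\<bar> \<le> B"
    and osc: "\<And>x y. g x - g y \<le> 2 * c"
  shows "(\<integral>x. g x \<partial>\<nu>1) - (\<integral>x. g x \<partial>\<nu>2) \<le> c * tv_norm \<nu>1 \<nu>2"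
proof -
  have bdd: "bdd_above (range g)" "bdd_below (range g)"
    using B by (auto simp: abs_le_iff intro!: bdd_aboveI2[where M=B] bdd_belowI2[where m="-B"] dest: minus_le_iff[THEN iffD1])
  define S I where "S = (SUP x. g x)" and "I = (INF x. g x)"
  define mid where "mid = (S + I) / 2"
  have spread: "S \<le> I + 2 * c"
    unfolding S_def
  proof (rule cSUP_least)
    fix x
    have "g x - 2 * c \<le> I"
      using osc[of x] unfolding I_def by (intro cINF_greatest) (auto simp: algebra_simps)
    then show "g x \<le> I + 2 * c" by simp
  qed simp
  have bounds: "g x \<le> S" "I \<le> g x" for x
    using bdd by (auto simp: S_def I_def intro: cSUP_upper cINF_lower)
  have mid: "\<bar>g x - mid\<bar> \<le> c" for x
  proof -
    have "2 * mid = S + I" by (simp add: mid_def)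
    with spread bounds[of x] show ?thesis by linarith
  qed
  interpret \<nu>1: prob_space \<nu>1 by (rule prob_measuresD[OF \<nu>(1)])
  interpret \<nu>2: prob_space \<nu>2 by (rule prob_measuresD[OF \<nu>(2)])
  have int: "integrable \<nu>1 g" "integrable \<nu>2 g"
    using \<nu> g B by (auto intro: integrable_prob_measure)
  have shift: "(\<integral>x. g x \<partial>\<nu>1) - (\<integral>x. g x \<partial>\<nu>2) = (\<integral>x. g x - mid \<partial>\<nu>1) - (\<integral>x. g x - mid \<partial>\<nu>2)"
    using int by (simp add: \<nu>1.prob_space \<nu>2.prob_space)
  show ?thesis
  proof (cases "c = 0")
    case True
    then have "g x - mid = 0" for x using mid[of x] by simp
    then show ?thesis unfolding shift by (simp add: True)
  next
    case False
    then have c: "0 < c" using mid[of undefined] by simp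
    have "(\<lambda>x. (g x - mid) / c) \<in> measurable_unit_ball"
      using g c mid by (auto simp: measurable_unit_ball_def)
    from integral_diff_le_tv_norm[OF \<nu> this]
    have "(\<integral>x. g x - mid \<partial>\<nu>1) / c - (\<integral>x. g x - mid \<partial>\<nu>2) / c \<le> tv_norm \<nu>1 \<nu>2"
      by simp
    then show ?thesis unfolding shift using c by (simp add: field_simps)
  qed
qed

context jump_model begin

text \<open>A solution is a measurable flow on nonnegative times only; its values at negative times are
  arbitrary and enter \<^const>\<open>jump_process\<close> on the null event of negative waiting times. There they
  may destroy measurability, and the integral of a non-measurable function is 0 by convention. Let
  \<open>N x\<close> say that \<open>f\<close> of the process started in \<open>x\<close> is measurable. The equation for \<open>f + c\<close> then reads
  \<open>\<integral> 1_N (e + c) dm0 = \<integral> f dmt + c\<close>, where \<open>e\<close> is the evolution along the extended flow. For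
  \<open>c > 1\<close> the right side is not 0, so the integrand on the left is integrable. Subtracting
  the equations for \<open>c = 2\<close> and \<open>c = 3\<close> gives \<open>m0 N = 1\<close>, so the convention has no effect.\<close>

lemma integral_evol_extend:
  assumes m0: "m0 \<in> prob_measures" and mt: "mt \<in> prob_measures"
    and ext: "(\<lambda>r. \<mu> (max 0 r)) \<in> borel \<rightarrow>\<^sub>M prob_algebra borel"
    and f: "f \<in> measurable_unit_ball"
    and sol: "\<And>g. g \<in> bounded_measurable \<Longrightarrow> (\<integral>x. evol \<mu> 0 t g x \<partial>m0) = (\<integral>x. g x \<partial>mt)"
  shows "(\<integral>x. evol (\<lambda>r. \<mu> (max 0 r)) 0 t f x \<partial>m0) = (\<integral>x. f x \<partial>mt)"
proof -
  note f_meas[measurable] = unit_ballD(1)[OF f] and f1 = unit_ballD(2)[OF f]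
  interpret m0: prob_space m0 by (rule prob_measuresD[OF m0])
  interpret mt: prob_space mt by (rule prob_measuresD[OF mt])
  define X where "X x = jump_process lmax rate G H (\<lambda>r. \<mu> (0 + r)) x (t - 0)" for x
  define Y where "Y x = jump_process lmax rate G H (\<lambda>r. \<mu> (max 0 (0 + r))) x (t - 0)" for x
  define N where "N x \<longleftrightarrow> (\<lambda>\<omega>. f (X x \<omega>)) \<in> borel_measurable jump_noise" for x
  let ?e = "evol (\<lambda>r. \<mu> (max 0 r)) 0 t f"
  have Y_meas[measurable]: "Y x \<in> jump_noise \<rightarrow>\<^sub>M borel" for x
    unfolding Y_def by (rule measurable_jump_process[OF ext]) auto
  have XY: "AE \<omega> in jump_noise. X x \<omega> = Y x \<omega>" for x
    using AE_noise_S_pos unfolding X_def Y_def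
    by eventually_elim (rule jump_process_cong_flow[OF lmax_pos], auto)
  \<comment> \<open>The two processes agree almost surely; where \<open>N x\<close> fails, the integral is 0 by convention.\<close>
  have evol_c: "evol \<mu> 0 t (\<lambda>y. f y + c) x = (if N x then ?e x + c else 0)" for c x
  proof (cases "N x")
    case True
    then have [measurable]: "(\<lambda>\<omega>. f (X x \<omega>)) \<in> borel_measurable jump_noise" by (simp add: N_def)
    have "(\<integral>\<omega>. f (X x \<omega>) + c \<partial>jump_noise) = (\<integral>\<omega>. f (Y x \<omega>) + c \<partial>jump_noise)"
      using XY[of x] by (intro integral_cong_AE) auto
    also have "\<dots> = (\<integral>\<omega>. f (Y x \<omega>) \<partial>jump_noise) + c"
      using jump_noise.integrable_bounded[of "\<lambda>\<omega>. f (Y x \<omega>)" 1] f1 jump_noise.prob_space by simp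
    finally show ?thesis using True by (simp add: flow_semigroup_def X_def Y_def)
  next
    case False
    have "\<not> integrable jump_noise (\<lambda>\<omega>. f (X x \<omega>) + c)"
    proof
      assume "integrable jump_noise (\<lambda>\<omega>. f (X x \<omega>) + c)"
      then have "(\<lambda>\<omega>. (f (X x \<omega>) + c) - c) \<in> borel_measurable jump_noise"
        by (intro borel_measurable_diff) auto
      then show False using False by (simp add: N_def)
    qed
    then show ?thesis using False by (simp add: flow_semigroup_def X_def not_integrable_integral_eq)
  qed
  have int_mt: "integrable mt f" by (rule integrable_prob_measure[OF mt f_meas f1])
  have sol_c: "(\<integral>x. (if N x then ?e x + c else 0) \<partial>m0) = (\<integral>x. f x \<partial>mt) + c" for c
  proof -
    have "(\<lambda>y. f y + c) \<in> bounded_measurable"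
      using f1 by (auto simp: bounded_measurable_def bounded_iff intro!: exI[of _ "1 + \<bar>c\<bar>"] order_trans[OF abs_triangle_ineq] add_mono)
    from sol[OF this] show ?thesis using int_mt mt.prob_space by (simp add: evol_c)
  qed
  have int_c: "integrable m0 (\<lambda>x. if N x then ?e x + c else 0)" if "1 < c" for c
  proof (rule ccontr)
    assume "\<not> integrable m0 (\<lambda>x. if N x then ?e x + c else 0)"
    then have "(\<integral>x. f x \<partial>mt) + c = 0" using sol_c[of c] by (simp add: not_integrable_integral_eq)
    then show False using mt.abs_integral_le_bound[of 1 f] f1 that by simp
  qed
  have int_N: "integrable m0 (\<lambda>x. if N x then 0 else 1::real)"
    and "(\<integral>x. (if N x then 0 else 1::real) \<partial>m0) = 0"
  proof -
    let ?F = "\<lambda>c x. if N x then ?e x + c else 0"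
    have eq: "(\<lambda>x. if N x then 0 else 1::real) = (\<lambda>x. 1 - (?F 3 x - ?F 2 x))" by auto
    show "integrable m0 (\<lambda>x. if N x then 0 else 1::real)"
      unfolding eq using int_c[of 2] int_c[of 3] by (intro Bochner_Integration.integrable_diff) auto
    have "(\<integral>x. 1 - (?F 3 x - ?F 2 x) \<partial>m0) = 1 - ((\<integral>x. ?F 3 x \<partial>m0) - (\<integral>x. ?F 2 x \<partial>m0))"
      using int_c[of 2] int_c[of 3] m0.prob_space by simp
    then show "(\<integral>x. (if N x then 0 else 1::real) \<partial>m0) = 0"
      unfolding eq by (simp add: sol_c)
  qed
  then have "AE x in m0. (if N x then 0 else 1::real) = 0"
    by (subst (asm) integral_nonneg_eq_0_iff_AE) auto
  then have AE_N: "AE x in m0. N x" by (auto elim!: eventually_mono split: if_splits)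
  have e_meas: "?e \<in> borel_measurable m0" and e1: "\<And>x. \<bar>?e x\<bar> \<le> 1"
    using unit_ballD[OF evol_unit_ball[OF ext f]] prob_measuresD(2)[OF m0] by (auto cong: measurable_cong_sets)
  have int_e: "integrable m0 ?e" by (rule m0.integrable_bounded[OF e_meas e1])
  have "(\<integral>x. f x \<partial>mt) + 2 = (\<integral>x. ?e x + 2 \<partial>m0)"
    unfolding sol_c[of 2, symmetric]
  proof (rule integral_cong_AE)
    show "AE x in m0. (if N x then ?e x + 2 else 0) = ?e x + 2"
      using AE_N by eventually_elim simp
    show "(\<lambda>x. if N x then ?e x + 2 else 0) \<in> borel_measurable m0"
      using int_c[of 2] by auto
  qed (use e_meas in auto)
  also have "\<dots> = (\<integral>x. ?e x \<partial>m0) + 2" using int_e m0.prob_space by simp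
  finally show ?thesis by simp
qed

end

text \<open>The Lipschitz hypothesis on \<open>rate (Q - 1)\<close> divided by \<open>lmax\<close>: adding the identity operator
  does not change differences.\<close>

locale lipschitz_jump_model = jump_model +
  fixes \<theta> :: real
  assumes \<theta>_pos: "0 < \<theta>"
    and jump_op_lipschitz: "\<And>\<nu>1 \<nu>2 f y. \<nu>1 \<in> prob_measures \<Longrightarrow> \<nu>2 \<in> prob_measures \<Longrightarrow>
      f \<in> measurable_unit_ball \<Longrightarrow> \<bar>jump_op \<nu>1 f y - jump_op \<nu>2 f y\<bar> \<le> \<theta> / lmax * tv_norm \<nu>1 \<nu>2"
begin

text \<open>Solutions with the flow property built in: \<open>m t = m s r(s,t)\<close> for all \<open>s\<close> and not just for \<open>s = 0\<close>.
  Measurability on the whole line lets the starting time of the evolution be any real number.\<close>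

definition evolves :: "(real \<Rightarrow> 'a measure) \<Rightarrow> bool" where
  "evolves m \<longleftrightarrow> m \<in> borel \<rightarrow>\<^sub>M prob_algebra borel \<and>
    (\<forall>s t f. 0 \<le> s \<longrightarrow> s \<le> t \<longrightarrow> f \<in> measurable_unit_ball \<longrightarrow>
       (\<integral>x. evol m s t f x \<partial>m s) = (\<integral>x. f x \<partial>m t))"

lemma evolvesI:
  assumes m: "m \<in> borel \<rightarrow>\<^sub>M prob_algebra borel"
    and sol: "\<And>t f. 0 \<le> t \<Longrightarrow> f \<in> measurable_unit_ball \<Longrightarrow> (\<integral>x. evol m 0 t f x \<partial>m0) = (\<integral>x. f x \<partial>m t)"
  shows "evolves m"
  unfolding evolves_def
proof (intro conjI allI impI m)
  fix s t :: real and f :: "'a \<Rightarrow> real" assume st: "0 \<le> s" "s \<le> t" and f: "f \<in> measurable_unit_ball"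
  have "(\<integral>x. evol m s t f x \<partial>m s) = (\<integral>x. evol m 0 s (evol m s t f) x \<partial>m0)"
    using sol[OF st(1) evol_unit_ball[OF m f]] by simp
  also have "\<dots> = (\<integral>x. f x \<partial>m t)"
    using evol_evol[OF m f st] sol[of t f] st f by simp
  finally show "(\<integral>x. evol m s t f x \<partial>m s) = (\<integral>x. f x \<partial>m t)" .
qed

text \<open>With \<open>r\<^sup>m\<close> and \<open>r\<^sup>h\<close> for the two evolutions,
  \<open>m t (f) - h t (f) = (m s - h s)(r\<^sup>m f) + h s (r\<^sup>m f - r\<^sup>h f)\<close>. The first term is controlled by the
  oscillation of \<open>r\<^sup>m f\<close>, the second by stability.\<close>

lemma tv_norm_step:
  assumes m: "evolves m" and h: "evolves h" and st: "0 \<le> s" "s \<le> t" and N: "0 \<le> N" and \<eta>: "0 < \<eta>"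
    and bound: "\<And>u. s \<le> u \<Longrightarrow> u \<le> t \<Longrightarrow> tv_norm (m u) (h u) \<le> N * exp (\<eta> * u)"
    and osc: "\<And>f x y. f \<in> measurable_unit_ball \<Longrightarrow> evol m s t f x - evol m s t f y \<le> 2 * c"
  shows "tv_norm (m t) (h t) \<le> c * tv_norm (m s) (h s) + \<theta> * N / \<eta> * (exp (\<eta> * t) - exp (\<eta> * s))"
proof -
  have meas: "m \<in> borel \<rightarrow>\<^sub>M prob_algebra borel" "h \<in> borel \<rightarrow>\<^sub>M prob_algebra borel"
    using m h by (auto simp: evolves_def)
  have p: "m u \<in> prob_measures" "h u \<in> prob_measures" for u
    using measurable_space[OF meas(1)] measurable_space[OF meas(2)] by auto
  show ?thesis
    unfolding tv_norm_le_iff[OF p]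
  proof
    fix f :: "'a \<Rightarrow> real" assume f: "f \<in> measurable_unit_ball"
    let ?m = "evol m s t f" and ?h = "evol h s t f"
    let ?b = "\<theta> * N / \<eta> * (exp (\<eta> * t) - exp (\<eta> * s))"
    note ball = evol_unit_ball[OF meas(1) f, of s t] evol_unit_ball[OF meas(2) f, of s t]
    have int: "integrable (h s) ?m" "integrable (h s) ?h"
      using unit_ballD[OF ball(1)] unit_ballD[OF ball(2)] by (auto intro!: integrable_prob_measure[OF p(2)])
    have diff: "\<bar>?m x - ?h x\<bar> \<le> ?b" for x
    proof (rule evol_diff_le[OF meas f _ \<eta> _ order_refl st(2)])
      show "0 \<le> \<theta> * N" using \<theta>_pos N by simp
      fix u y and \<phi> :: "'a \<Rightarrow> real" assume u: "s \<le> u" "u \<le> t" and \<phi>: "\<phi> \<in> measurable_unit_ball"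
      have "\<bar>jump_op (m u) \<phi> y - jump_op (h u) \<phi> y\<bar> \<le> \<theta> / lmax * tv_norm (m u) (h u)"
        by (rule jump_op_lipschitz[OF p \<phi>])
      also have "\<dots> \<le> \<theta> / lmax * (N * exp (\<eta> * u))"
        using \<theta>_pos lmax_pos by (intro mult_left_mono bound u) auto
      finally show "\<bar>jump_op (m u) \<phi> y - jump_op (h u) \<phi> y\<bar> \<le> \<theta> * N / lmax * exp (\<eta> * u)"
        by simp
    qed
    have "(\<integral>x. f x \<partial>m t) - (\<integral>x. f x \<partial>h t) = (\<integral>x. ?m x \<partial>m s) - (\<integral>x. ?h x \<partial>h s)"
      using m h st f by (simp add: evolves_def)
    also have "\<dots> = ((\<integral>x. ?m x \<partial>m s) - (\<integral>x. ?m x \<partial>h s)) + (\<integral>x. ?m x - ?h x \<partial>h s)"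
      using int by simp
    also have "(\<integral>x. ?m x \<partial>m s) - (\<integral>x. ?m x \<partial>h s) \<le> c * tv_norm (m s) (h s)"
      by (rule integral_diff_le_oscillation[OF p unit_ballD[OF ball(1)] osc[OF f]])
    also have "(\<integral>x. ?m x - ?h x \<partial>h s) \<le> ?b"
    proof -
      have "0 \<le> ?b" using diff[of undefined] by simp
      then have "\<bar>\<integral>x. ?m x - ?h x \<partial>h s\<bar> \<le> ?b"
        using diff by (intro prob_space.abs_integral_le_bound[OF prob_measuresD(1)[OF p(2)]])
      then show ?thesis by simp
    qed
    finally show "(\<integral>x. f x \<partial>m t) - (\<integral>x. f x \<partial>h t) \<le> c * tv_norm (m s) (h s) + ?b"
      by simp
  qed
qed

text \<open>Let \<open>v u = \<parallel>m u - h u\<parallel>\<close> and \<open>\<eta> > \<theta>\<close>. A bound \<open>v u \<le> (v s + M) exp(\<eta> (u-s))\<close> improves by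
  \<open>tv_norm_step\<close> to one with \<open>\<theta>/\<eta> M\<close> in place of \<open>M\<close>. Exponential bounds keep their shape, so all
  integrals over time are explicit; finally \<open>\<eta>\<close> decreases to \<open>\<theta>\<close>.\<close>

lemma tv_norm_gronwall:
  assumes m: "evolves m" and h: "evolves h" and st: "0 \<le> s" "s \<le> t"
  shows "tv_norm (m t) (h t) \<le> tv_norm (m s) (h s) * exp (\<theta> * (t - s))"
proof -
  have meas: "m \<in> borel \<rightarrow>\<^sub>M prob_algebra borel" "h \<in> borel \<rightarrow>\<^sub>M prob_algebra borel"
    using m h by (auto simp: evolves_def)
  have p: "m u \<in> prob_measures" "h u \<in> prob_measures" for u
    using measurable_space[OF meas(1)] measurable_space[OF meas(2)] by auto
  define v where "v u = tv_norm (m u) (h u)" for u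
  have v: "0 \<le> v u" "v u \<le> 2" for u
    using tv_norm_nonneg[OF p] tv_norm_le_2[OF p] by (auto simp: v_def)
  have osc1: "evol m s u f x - evol m s u f y \<le> 2 * 1" if "f \<in> measurable_unit_ball" for u f x y
    using abs_evol_le[of 1 f m s u x] abs_evol_le[of 1 f m s u y] unit_ballD(2)[OF that] by simp
  have step: "v u * exp (- \<eta> * (u - s)) \<le> v s + \<theta> / \<eta> * M"
    if \<eta>: "\<theta> < \<eta>" and M: "0 \<le> M" and u: "s \<le> u"
      and IH: "\<And>r. s \<le> r \<Longrightarrow> v r * exp (- \<eta> * (r - s)) \<le> v s + M" for \<eta> M u
  proof -
    have \<eta>0: "0 < \<eta>" using \<eta> \<theta>_pos by simp
    let ?N = "(v s + M) * exp (- \<eta> * s)" and ?q = "exp (- \<eta> * (u - s))"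
    have q: "0 < ?q" "?q \<le> 1" using u \<eta>0 by auto
    have "v u \<le> 1 * v s + \<theta> * ?N / \<eta> * (exp (\<eta> * u) - exp (\<eta> * s))"
      unfolding v_def
    proof (rule tv_norm_step[OF m h st(1) u _ \<eta>0 _ osc1])
      show "0 \<le> (tv_norm (m s) (h s) + M) * exp (- \<eta> * s)"
        using v(1)[of s] M by (simp add: v_def)
      fix r assume "s \<le> r" "r \<le> u"
      then have "v r * exp (- \<eta> * (r - s)) * exp (\<eta> * (r - s)) \<le> (v s + M) * exp (\<eta> * (r - s))"
        by (intro mult_right_mono IH) auto
      then show "tv_norm (m r) (h r) \<le> (tv_norm (m s) (h s) + M) * exp (- \<eta> * s) * exp (\<eta> * r)"
        unfolding v_def mult.assoc exp_add[symmetric] by (simp add: algebra_simps)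
    qed
    then have "v u * ?q \<le> (1 * v s + \<theta> * ?N / \<eta> * (exp (\<eta> * u) - exp (\<eta> * s))) * ?q"
      using q by (intro mult_right_mono) auto
    also have "\<dots> = v s * ?q + \<theta> / \<eta> * (v s + M) * (1 - ?q)"
    proof -
      have "exp (- \<eta> * s) * (exp (\<eta> * u) - exp (\<eta> * s)) * ?q = 1 - ?q"
        by (simp add: right_diff_distrib left_diff_distrib exp_add[symmetric] algebra_simps)
      then have e: "\<theta> / \<eta> * (v s + M) * (exp (- \<eta> * s) * (exp (\<eta> * u) - exp (\<eta> * s)) * ?q) = \<theta> / \<eta> * (v s + M) * (1 - ?q)"
        by simp
      have "(1 * a + \<theta> * ((a + M) * E) / \<eta> * D) * r = a * r + \<theta> / \<eta> * (a + M) * (E * D * r)" for a E D r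
        using \<eta>0 by (simp add: field_simps)
      then show ?thesis unfolding e[symmetric] .
    qed
    also have "\<dots> \<le> v s * ?q + (1 * v s + \<theta> / \<eta> * M) * (1 - ?q)"
    proof -
      have "\<theta> / \<eta> * v s \<le> 1 * v s"
        using \<eta> \<eta>0 v(1)[of s] by (intro mult_right_mono) auto
      then show ?thesis
        using q by (intro add_left_mono mult_right_mono) (auto simp: distrib_left)
    qed
    also have "\<dots> = v s + \<theta> / \<eta> * M * (1 - ?q)" by (simp add: algebra_simps)
    also have "\<dots> \<le> v s + \<theta> / \<eta> * M"
      using \<theta>_pos \<eta>0 M q by (intro add_left_mono mult_left_le) auto
    finally show ?thesis .
  qed
  have weak: "v t \<le> v s * exp (\<eta> * (t - s))" if \<eta>: "\<theta> < \<eta>" for \<eta>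
  proof -
    have \<eta>0: "0 < \<eta>" using \<eta> \<theta>_pos by simp
    have "v t * exp (- \<eta> * (t - s)) \<le> v s"
    proof (rule le_if_contraction[where I="{s..}" and c="\<theta> / \<eta>" and C=2
          and D="\<lambda>u. v u * exp (- \<eta> * (u - s))" and b="\<lambda>_. v s"])
      show "v u * exp (- \<eta> * (u - s)) \<le> v s + 2" if "u \<in> {s..}" for u
      proof -
        have "v u * exp (- \<eta> * (u - s)) \<le> v u * 1"
          using that \<eta>0 v(1)[of u] by (intro mult_left_mono) auto
        then show ?thesis using v(2)[of u] v(1)[of s] by simp
      qed
    qed (use \<eta> \<eta>0 \<theta>_pos st step[OF \<eta>] in auto)
    then have "v t * exp (- \<eta> * (t - s)) * exp (\<eta> * (t - s)) \<le> v s * exp (\<eta> * (t - s))"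
      by (intro mult_right_mono) auto
    then show ?thesis by (simp add: mult.assoc exp_add[symmetric] algebra_simps)
  qed
  have "(\<lambda>n. v s * exp ((\<theta> + 1 / real (Suc n)) * (t - s))) \<longlonglongrightarrow> v s * exp ((\<theta> + 0) * (t - s))"
    by (intro tendsto_intros LIMSEQ_Suc[OF lim_1_over_n])
  then have "v t \<le> v s * exp ((\<theta> + 0) * (t - s))"
    by (rule LIMSEQ_le_const) (auto intro!: weak simp del: of_nat_Suc)
  then show ?thesis by (simp add: v_def)
qed

text \<open>With probability \<open>exp(-lmax t0)\<close> the clock is silent and the oscillation is at most \<open>2 (1 - \<alpha>)\<close>;
  otherwise it is at most 2.\<close>

lemma evol_oscillation_le:
  assumes \<mu>[measurable]: "\<mu> \<in> borel \<rightarrow>\<^sub>M prob_algebra borel" and f: "f \<in> measurable_unit_ball"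
    and t0: "0 \<le> t0" and doeblin: "\<And>x y. heat t0 f x - heat t0 f y \<le> 2 * (1 - \<alpha>)"
  shows "evol \<mu> s (s + t0) f x - evol \<mu> s (s + t0) f y \<le> 2 * (1 - \<alpha> * exp (- lmax * t0))"
proof -
  note [measurable] = unit_ballD(1)[OF f] and f1 = unit_ballD(2)[OF f]
  let ?h = "\<lambda>x \<tau>. heat \<tau> (jump_op (\<mu> (s + \<tau>)) (evol \<mu> (s + \<tau>) (s + t0) f)) x"
  let ?F = "\<lambda>x \<tau>. if t0 < \<tau> then heat t0 f x else ?h x \<tau>"
  \<comment> \<open>The second summand is that of \<open>integral_exp_law_upto\<close> for the constant function \<open>2 * \<alpha>\<close>.\<close>
  let ?B = "\<lambda>\<tau>. 2 * (1 - \<alpha>) + (if t0 < \<tau> then 0 else 2 * \<alpha> - 0 / lmax)"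
  have h1: "\<bar>?h x \<tau>\<bar> \<le> 1" for x \<tau>
    by (intro abs_heat_le abs_jump_op_le abs_evol_le f1) auto
  have F1: "\<bar>?F x \<tau>\<bar> \<le> 1" for x \<tau>
    using h1 by (auto intro!: abs_heat_le f1)
  have Fint: "integrable (exp_law lmax) (?F x)" for x
    by (rule clock.integrable_bounded[OF _ F1]) measurable
  have Bint: "integrable (exp_law lmax) (\<lambda>\<tau>. if t0 < \<tau> then 0 else 2 * \<alpha> - 0 / lmax)"
    by (intro clock.integrable_bounded[where C="\<bar>2 * \<alpha>\<bar>"]) auto
  have "evol \<mu> s (s + t0) f x - evol \<mu> s (s + t0) f y = (\<integral>\<tau>. ?F x \<tau> - ?F y \<tau> \<partial>exp_law lmax)"
    using Fint t0 by (simp add: evol_first_jump[OF \<mu> f] cong: if_cong)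
  also have "\<dots> \<le> (\<integral>\<tau>. ?B \<tau> \<partial>exp_law lmax)"
  proof (rule integral_mono)
    show "?F x \<tau> - ?F y \<tau> \<le> ?B \<tau>" for \<tau>
      using doeblin[of x y] h1[of \<tau> x] h1[of \<tau> y] by (auto simp: abs_le_iff)
  qed (use Fint Bint in auto)
  also have "\<dots> = 2 * (1 - \<alpha>) + (\<integral>\<tau>. (if t0 < \<tau> then 0 else 2 * \<alpha> - 0 / lmax) \<partial>exp_law lmax)"
    using Bint clock.prob_space by simp
  also have "(\<integral>\<tau>. (if t0 < \<tau> then 0 else 2 * \<alpha> - 0 / lmax) \<partial>exp_law lmax) = 2 * \<alpha> - exp (- lmax * t0) * (2 * \<alpha>)"
    by (rule integral_exp_law_upto[OF lmax_pos t0]) (auto intro!: derivative_eq_intros)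
  finally show ?thesis by (simp add: algebra_simps)
qed

text \<open>Over one period \<open>tv_norm_step\<close> is applied with the bound of \<open>tv_norm_gronwall\<close>, so that
  \<open>\<eta> = \<theta>\<close>; its last term is \<open>(exp(\<theta> t0) - 1) \<parallel>m s - h s\<parallel>\<close>.\<close>

theorem tv_norm_contraction:
  assumes m: "evolves m" and h: "evolves h" and t0: "0 < t0" and \<alpha>: "0 \<le> \<alpha>"
    and doeblin: "\<And>x y. tv_norm (P t0 x) (P t0 y) \<le> 2 * (1 - \<alpha>)" and t: "0 \<le> t"
  shows "tv_norm (m t) (h t) \<le>
    exp (\<theta> * t0) * (exp (\<theta> * t0) - \<alpha> * exp (- lmax * t0)) ^ nat \<lfloor>t / t0\<rfloor> * tv_norm (m 0) (h 0)"
proof -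
  have meas: "m \<in> borel \<rightarrow>\<^sub>M prob_algebra borel" "h \<in> borel \<rightarrow>\<^sub>M prob_algebra borel"
    using m h by (auto simp: evolves_def)
  have p: "m u \<in> prob_measures" "h u \<in> prob_measures" for u
    using measurable_space[OF meas(1)] measurable_space[OF meas(2)] by auto
  have P: "P t0 x \<in> prob_measures" for x
    using measurable_space[OF P_kernel, of t0 x] t0 by simp
  define v where "v u = tv_norm (m u) (h u)" for u
  let ?\<rho> = "exp (\<theta> * t0) - \<alpha> * exp (- lmax * t0)"
  have v: "0 \<le> v u" for u using tv_norm_nonneg[OF p] by (simp add: v_def)
  \<comment> \<open>The distance of a law to itself is nonnegative, which forces \<open>\<alpha> \<le> 1\<close> and keeps the factor nonnegative.\<close>
  have "\<alpha> \<le> 1"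
    using doeblin[of undefined undefined] tv_norm_nonneg[OF P P, of undefined undefined] by simp
  then have "\<alpha> * exp (- lmax * t0) \<le> 1 * 1"
    using \<alpha> t0 lmax_pos by (intro mult_mono) auto
  moreover have "1 \<le> exp (\<theta> * t0)" using \<theta>_pos t0 by simp
  ultimately have \<rho>: "0 \<le> ?\<rho>" by linarith
  have osc: "evol m s (s + t0) f x - evol m s (s + t0) f y \<le> 2 * (1 - \<alpha> * exp (- lmax * t0))"
    if f: "f \<in> measurable_unit_ball" for s f x y
  proof (rule evol_oscillation_le[OF meas(1) f])
    fix x y
    show "heat t0 f x - heat t0 f y \<le> 2 * (1 - \<alpha>)"
      using integral_diff_le_tv_norm[OF P P f, of x y] doeblin[of x y] t0
      by (simp add: integral_P_eq_heat unit_ballD(1)[OF f])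
  qed (use t0 in simp)
  have one: "v (s + t0) \<le> ?\<rho> * v s" if s: "0 \<le> s" for s
  proof -
    let ?N = "v s * exp (- \<theta> * s)"
    have "v (s + t0) \<le> (1 - \<alpha> * exp (- lmax * t0)) * v s + \<theta> * ?N / \<theta> * (exp (\<theta> * (s + t0)) - exp (\<theta> * s))"
      unfolding v_def
    proof (rule tv_norm_step[OF m h s _ _ \<theta>_pos _ osc])
      show "s \<le> s + t0" using t0 by simp
      show "0 \<le> tv_norm (m s) (h s) * exp (- \<theta> * s)" using v[of s] by (simp add: v_def)
      fix u assume "s \<le> u" "u \<le> s + t0"
      then have "tv_norm (m u) (h u) \<le> tv_norm (m s) (h s) * exp (\<theta> * (u - s))"
        using s by (intro tv_norm_gronwall[OF m h])
      then show "tv_norm (m u) (h u) \<le> tv_norm (m s) (h s) * exp (- \<theta> * s) * exp (\<theta> * u)"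
        unfolding mult.assoc exp_add[symmetric] by (simp add: algebra_simps)
    qed
    also have "\<theta> * ?N / \<theta> * (exp (\<theta> * (s + t0)) - exp (\<theta> * s)) = v s * (exp (\<theta> * t0) - 1)"
    proof -
      have "exp (- \<theta> * s) * (exp (\<theta> * (s + t0)) - exp (\<theta> * s)) = exp (\<theta> * t0) - 1"
        by (simp add: right_diff_distrib exp_add[symmetric] algebra_simps)
      then show ?thesis using \<theta>_pos by (simp add: mult.assoc)
    qed
    finally show ?thesis by (simp add: algebra_simps)
  qed
  have iter: "v (real n * t0) \<le> ?\<rho> ^ n * v 0" for n
  proof (induction n)
    case (Suc n)
    have "v (real (Suc n) * t0) \<le> ?\<rho> * v (real n * t0)"
      using one[of "real n * t0"] t0 by (simp add: algebra_simps)
    also have "\<dots> \<le> ?\<rho> * (?\<rho> ^ n * v 0)" by (rule mult_left_mono[OF Suc \<rho>])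
    finally show ?case by (simp add: mult.assoc)
  qed simp
  let ?n = "nat \<lfloor>t / t0\<rfloor>"
  have n: "real ?n \<le> t / t0" "t / t0 < real ?n + 1"
    using t t0 by (auto simp: of_nat_nat)
  have n': "real ?n * t0 \<le> t" "t - real ?n * t0 \<le> t0"
    using n t0 by (auto simp: field_simps)
  have "v t \<le> v (real ?n * t0) * exp (\<theta> * (t - real ?n * t0))"
    unfolding v_def using t0 n' by (intro tv_norm_gronwall[OF m h]) auto
  also have "\<dots> \<le> (?\<rho> ^ ?n * v 0) * exp (\<theta> * t0)"
    using n' \<theta>_pos \<rho> v[of 0] by (intro mult_mono iter) auto
  finally show ?thesis by (simp add: v_def mult_ac)
qed

end

theorem theorem1:
  fixes P :: "real \<Rightarrow> 'e::polish_space \<Rightarrow> 'e measure"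
    and \<Omega> :: "'e \<Rightarrow> 'w measure" and F :: "'e \<Rightarrow> real \<Rightarrow> 'w measure"
    and Z :: "'e \<Rightarrow> real \<Rightarrow> 'w \<Rightarrow> 'e"
    and rate :: "'e measure \<Rightarrow> 'e \<Rightarrow> real" and Q :: "'e measure \<Rightarrow> 'e \<Rightarrow> 'e measure"
    and G :: "'e measure \<Rightarrow> 'e \<Rightarrow> real \<Rightarrow> 'e" and H :: "'e \<Rightarrow> real \<Rightarrow> real \<Rightarrow> 'e"
    and m h :: "real \<Rightarrow> 'e measure" and m0 h0 :: "'e measure"
    and lmax \<theta> t0 \<alpha> t :: real
  assumes feller: "feller_semigroup P"
    and Z_markov: "\<And>x. cadlag_strong_markov P (\<Omega> x) (F x) (Z x)"
    and Z_init: "\<And>x \<omega>. \<omega> \<in> space (\<Omega> x) \<Longrightarrow> Z x 0 \<omega> = x"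
    and Z_semigroup: "\<And>s x f. 0 \<le> s \<Longrightarrow> f \<in> bounded_measurable \<Longrightarrow>
          (\<integral>y. f y \<partial>P s x) = (\<integral>\<omega>. f (Z x s \<omega>) \<partial>\<Omega> x)"
    and rate_nonneg: "\<And>\<nu> x. \<nu> \<in> prob_measures \<Longrightarrow> 0 \<le> rate \<nu> x"
    and rate_measurable: "(\<lambda>(\<nu>, x). rate \<nu> x) \<in> prob_algebra borel \<Otimes>\<^sub>M borel \<rightarrow>\<^sub>M borel"
    and Q_kernel: "\<And>\<nu>. \<nu> \<in> prob_measures \<Longrightarrow> Q \<nu> \<in> borel \<rightarrow>\<^sub>M prob_algebra borel"
    and G_measurable:
      "(\<lambda>(\<nu>, x, u). G \<nu> x u) \<in> prob_algebra borel \<Otimes>\<^sub>M borel \<Otimes>\<^sub>M unif01 \<rightarrow>\<^sub>M borel"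
    and G_represents: "\<And>\<nu> x. \<nu> \<in> prob_measures \<Longrightarrow> distr unif01 borel (G \<nu> x) = Q \<nu> x"
    and H_measurable: "(\<lambda>(x, u). H x u) \<in> borel \<Otimes>\<^sub>M unif01 \<rightarrow>\<^sub>M skorokhod_borel"
    and H_represents: "\<And>x. distr unif01 skorokhod_borel (H x) = path_law (\<Omega> x) (Z x)"
    and lmax_pos: "0 < lmax"
    and rate_le: "\<And>\<nu> x. \<nu> \<in> prob_measures \<Longrightarrow> rate \<nu> x \<le> lmax"
    and \<theta>_pos: "0 < \<theta>"
    and lipschitz: "\<And>\<nu>1 \<nu>2. \<nu>1 \<in> prob_measures \<Longrightarrow> \<nu>2 \<in> prob_measures \<Longrightarrow>
          (SUP f\<in>measurable_unit_ball. sup_norm (\<lambda>x.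
             rate \<nu>1 x * ((\<integral>y. f y \<partial>Q \<nu>1 x) - f x) - rate \<nu>2 x * ((\<integral>y. f y \<partial>Q \<nu>2 x) - f x)))
          \<le> \<theta> * tv_norm \<nu>1 \<nu>2"
    and t0_pos: "0 < t0" and \<alpha>_nonneg: "0 \<le> \<alpha>"
    and doeblin: "\<And>x y. tv_norm (P t0 x) (P t0 y) \<le> 2 * (1 - \<alpha>)"
    and m0: "m0 \<in> prob_measures" and h0: "h0 \<in> prob_measures"
    and m_solution: "nonlinear_solution lmax rate G H m0 m"
    and h_solution: "nonlinear_solution lmax rate G H h0 h"
    and t_nonneg: "0 \<le> t"
  shows "tv_norm (m t) (h t) \<le>
    exp (\<theta> * t0) * (exp (\<theta> * t0) - \<alpha> * exp (- lmax * t0)) ^ nat \<lfloor>t / t0\<rfloor> * tv_norm m0 h0"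
proof -
  have P_kernel: "P s \<in> borel \<rightarrow>\<^sub>M prob_algebra borel" if "0 \<le> s" for s
    using feller that by (auto simp: feller_semigroup_def)
  have H_eval: "(\<lambda>(x, u, s). H x u s) \<in> borel \<Otimes>\<^sub>M unif01 \<Otimes>\<^sub>M borel \<rightarrow>\<^sub>M borel"
  proof -
    have "(\<lambda>z. H (fst z) (fst (snd z))) \<in> borel \<Otimes>\<^sub>M unif01 \<Otimes>\<^sub>M borel \<rightarrow>\<^sub>M skorokhod_borel"
      using measurable_compose[OF measurable_Pair[OF measurable_fst measurable_compose[OF measurable_snd measurable_fst]] H_measurable]
      by simp
    from measurable_compose[OF measurable_Pair[OF this measurable_compose[OF measurable_snd measurable_snd]] measurable_cadlag_eval]
    show ?thesis by (simp add: split_beta)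
  qed
  have H_law: "distr unif01 borel (\<lambda>u. H x u s) = P s x" if s: "0 \<le> s" for s x
  proof -
    let ?Z = "\<lambda>\<omega>. \<lambda>t\<in>{0..}. Z x t \<omega>"
    have H_path: "H x \<in> unif01 \<rightarrow>\<^sub>M skorokhod_borel"
      using measurable_compose[OF measurable_Pair1'[of x borel unif01] H_measurable] by simp
    note ev = measurable_cadlag_eval_at[OF s]
    interpret \<Omega>: prob_space "\<Omega> x"
      using Z_markov[of x] by (simp add: cadlag_strong_markov_def)
    \<comment> \<open>The law of the paths is that of \<open>H x\<close>, hence a probability measure.\<close>
    have "prob_space (distr (\<Omega> x) skorokhod_borel ?Z)"
      using unif01.prob_space_distr[OF H_path] H_represents[of x] by (simp add: path_law_def)
    then have Z_path: "?Z \<in> \<Omega> x \<rightarrow>\<^sub>M skorokhod_borel"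
      using Z_markov[of x]
      by (intro measurable_if_distr_prob_space \<Omega>.prob_space_axioms)
        (auto simp: cadlag_strong_markov_def space_skorokhod_borel)
    have "distr unif01 borel (\<lambda>u. H x u s) = distr (distr unif01 skorokhod_borel (H x)) borel (\<lambda>w. w s)"
      by (subst distr_distr[OF ev H_path]) (simp add: comp_def)
    also have "\<dots> = distr (distr (\<Omega> x) skorokhod_borel ?Z) borel (\<lambda>w. w s)"
      by (simp add: H_represents path_law_def)
    also have "\<dots> = distr (\<Omega> x) borel (Z x s)"
      using s by (subst distr_distr[OF ev Z_path]) (simp add: comp_def)
    also have "\<dots> = P s x"
    proof (rule measure_eqI)
      have Px: "P s x \<in> prob_measures"
        using measurable_space[OF P_kernel[OF s]] by simp
      interpret Px: prob_space "P s x" by (rule prob_measuresD[OF Px])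
      have Zs: "Z x s \<in> \<Omega> x \<rightarrow>\<^sub>M borel"
        using measurable_compose[OF Z_path ev] s by simp
      interpret D: prob_space "distr (\<Omega> x) borel (Z x s)"
        by (rule \<Omega>.prob_space_distr[OF Zs])
      show "sets (distr (\<Omega> x) borel (Z x s)) = sets (P s x)"
        using prob_measuresD(2)[OF Px] by simp
      fix A assume "A \<in> sets (distr (\<Omega> x) borel (Z x s))"
      then have A: "A \<in> sets borel" by simp
      then have "indicator A \<in> bounded_measurable"
        by (auto simp: bounded_measurable_def bounded_iff indicator_def intro!: exI[of _ 1])
      from Z_semigroup[OF s this, of x]
      have "measure (P s x) A = (\<integral>\<omega>. indicator A (Z x s \<omega>) \<partial>\<Omega> x)"
        using A prob_measuresD(2)[OF Px] by (simp add: sets.sets_into_space)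
      also have "\<dots> = measure (distr (\<Omega> x) borel (Z x s)) A"
        using A by (subst integral_distr[OF Zs, symmetric]) auto
      finally show "emeasure (distr (\<Omega> x) borel (Z x s)) A = emeasure (P s x) A"
        by (simp add: D.emeasure_eq_measure Px.emeasure_eq_measure)
    qed
    finally show ?thesis .
  qed
  interpret jump_model P rate G H lmax
  proof
    show "P 0 x = return borel x" for x using feller by (simp add: feller_semigroup_def)
    show "P (s + u) x = P s x \<bind> P u" if "0 \<le> s" "0 \<le> u" for s u x
      using feller that by (simp add: feller_semigroup_def)
  qed (use P_kernel rate_measurable rate_nonneg rate_le G_measurable H_eval H_law lmax_pos in auto)

  \<comment> \<open>Integrating out the acceptance variable \<open>V\<close> identifies \<open>lmax (jump_op \<nu> f - f)\<close> with
    \<open>rate \<nu> (Q \<nu> f - f)\<close>, the operator of the Lipschitz hypothesis.\<close>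
  define gen where "gen \<nu> f y = rate \<nu> y * ((\<integral>z. f z \<partial>Q \<nu> y) - f y)" for \<nu> y and f :: "'e \<Rightarrow> real"
  have jump_op_gen: "lmax * (jump_op \<nu> f y - f y) = gen \<nu> f y"
    if \<nu>: "\<nu> \<in> prob_measures" and f: "f \<in> measurable_unit_ball" for \<nu> f y
  proof -
    let ?A = "\<integral>z. f z \<partial>Q \<nu> y" and ?p = "rate \<nu> y / lmax"
    have p: "0 \<le> ?p" "?p \<le> 1" using rate_nonneg[OF \<nu>] rate_le[OF \<nu>] lmax_pos by auto
    have "(\<lambda>w. G \<nu> y w) \<in> unif01 \<rightarrow>\<^sub>M borel"
      using measurable_compose[OF measurable_Pair[OF measurable_const[OF \<nu>] measurable_Pair1'[of y borel unif01]] G_measurable]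
      by simp
    then have A: "(\<integral>w. f (G \<nu> y w) \<partial>unif01) = ?A"
      unfolding G_represents[OF \<nu>, symmetric] by (subst integral_distr) (auto simp: unit_ballD(1)[OF f])
    have "jump_op \<nu> f y = (\<integral>v. f y + (?A - f y) * indicator {..?p} v \<partial>unif01)"
      unfolding jump_op_def post_jump_def
      by (intro Bochner_Integration.integral_cong refl)
        (auto simp: A measure_unif01 split: split_indicator)
    also have "\<dots> = f y + (?A - f y) * measure unif01 ({..?p} \<inter> {0..1})"
    proof -
      have "(indicator {..?p} :: real \<Rightarrow> real) \<in> borel_measurable unif01" by (intro measurable_restrict_space1) simp
      then have "integrable unif01 (indicator {..?p} :: real \<Rightarrow> real)"
        by (intro unif01.integrable_bounded[where C=1]) (auto split: split_indicator)
      then show ?thesis by (simp add: measure_unif01)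
    qed
    also have "measure unif01 ({..?p} \<inter> {0..1}) = ?p"
    proof -
      have "{..?p} \<inter> {0..1} = {0..?p}" using p by auto
      then show ?thesis using p by (simp add: measure_restrict_space)
    qed
    finally show ?thesis using lmax_pos by (simp add: gen_def field_simps)
  qed
  have gen_bound: "\<bar>gen \<nu> f y\<bar> \<le> 2 * lmax"
    if "\<nu> \<in> prob_measures" and f: "f \<in> measurable_unit_ball" for \<nu> f y
  proof -
    have "\<bar>jump_op \<nu> f y - f y\<bar> \<le> 2"
      using abs_jump_op_le[of 1 f \<nu> y, OF _ unit_ballD(2)[OF f]] unit_ballD(2)[OF f, of y] by linarith
    then show ?thesis
      using lmax_pos by (simp add: jump_op_gen[OF that, symmetric] abs_mult)
  qed
  interpret lipschitz_jump_model P rate G H lmax \<theta>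
  proof
    fix \<nu>1 \<nu>2 :: "'e measure" and f :: "'e \<Rightarrow> real" and y
    assume \<nu>: "\<nu>1 \<in> prob_measures" "\<nu>2 \<in> prob_measures" and f: "f \<in> measurable_unit_ball"
    let ?d = "\<lambda>f x. gen \<nu>1 f x - gen \<nu>2 f x"
    have d: "\<bar>?d f x\<bar> \<le> 4 * lmax" if "f \<in> measurable_unit_ball" for f x
      using gen_bound[OF \<nu>(1) that, of x] gen_bound[OF \<nu>(2) that, of x] by simp
    have "\<bar>?d f y\<bar> \<le> sup_norm (?d f)"
      unfolding sup_norm_def using d[OF f] by (intro cSUP_upper bdd_aboveI2) auto
    also have "\<dots> \<le> (SUP f\<in>measurable_unit_ball. sup_norm (?d f))"
      unfolding sup_norm_def using d
      by (intro cSUP_upper f bdd_aboveI2[where M="4 * lmax"] cSUP_least) auto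
    also have "\<dots> \<le> \<theta> * tv_norm \<nu>1 \<nu>2"
      using lipschitz[OF \<nu>] by (simp add: gen_def)
    finally have "\<bar>lmax * (jump_op \<nu>1 f y - jump_op \<nu>2 f y)\<bar> \<le> \<theta> * tv_norm \<nu>1 \<nu>2"
      using jump_op_gen[OF \<nu>(1) f, of y] jump_op_gen[OF \<nu>(2) f, of y] by (simp add: algebra_simps)
    then have "lmax * \<bar>jump_op \<nu>1 f y - jump_op \<nu>2 f y\<bar> \<le> \<theta> * tv_norm \<nu>1 \<nu>2"
      unfolding abs_mult using lmax_pos by simp
    then show "\<bar>jump_op \<nu>1 f y - jump_op \<nu>2 f y\<bar> \<le> \<theta> / lmax * tv_norm \<nu>1 \<nu>2"
      using lmax_pos by (simp add: field_simps)
  qed (rule \<theta>_pos)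

  \<comment> \<open>Freezing the flow at its initial value for negative times makes it measurable on the whole line.\<close>
  define ext where "ext \<mu> r = \<mu> (max 0 r)" for \<mu> :: "real \<Rightarrow> 'e measure" and r
  have ext: "evolves (ext \<mu>)" "tv_norm (ext \<mu> 0) \<nu> = tv_norm \<mu>0 \<nu>" "tv_norm \<nu> (ext \<mu> 0) = tv_norm \<nu> \<mu>0"
    if \<mu>0: "\<mu>0 \<in> prob_measures" and "nonlinear_solution lmax rate G H \<mu>0 \<mu>" for \<mu> \<mu>0 \<nu>
  proof -
    have \<mu>: "\<mu> \<in> measure_flows" and sol: "\<And>t f. 0 \<le> t \<Longrightarrow> f \<in> bounded_measurable \<Longrightarrow>
        (\<integral>x. evol \<mu> 0 t f x \<partial>\<mu>0) = (\<integral>x. f x \<partial>\<mu> t)"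
      using that(2) by (auto simp: nonlinear_solution_def)
    have "(\<lambda>r. max 0 r) \<in> borel \<rightarrow>\<^sub>M restrict_space borel {0::real..}"
      by (intro measurable_restrict_space2) auto
    from measurable_compose[OF this \<mu>] have ext_meas: "ext \<mu> \<in> borel \<rightarrow>\<^sub>M prob_algebra borel"
      by (simp add: ext_def[abs_def])
    have ext_sol: "(\<integral>x. evol (ext \<mu>) 0 t f x \<partial>\<mu>0) = (\<integral>x. f x \<partial>ext \<mu> t)"
      if "0 \<le> t" "f \<in> measurable_unit_ball" for t f
    proof -
      have "\<mu> t \<in> prob_measures" using measurable_space[OF \<mu>, of t] that(1) by simp
      then show ?thesis
        using integral_evol_extend[OF \<mu>0 _ _ that(2) sol[OF that(1)]] ext_meas that(1) by (simp add: ext_def[abs_def])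
    qed
    show "evolves (ext \<mu>)" by (rule evolvesI[OF ext_meas ext_sol])
    have "(\<integral>x. f x \<partial>ext \<mu> 0) = (\<integral>x. f x \<partial>\<mu>0)" if "f \<in> measurable_unit_ball" for f
      using ext_sol[of 0 f] that by (simp add: evol_refl[OF ext_meas])
    then show "tv_norm (ext \<mu> 0) \<nu> = tv_norm \<mu>0 \<nu>" "tv_norm \<nu> (ext \<mu> 0) = tv_norm \<nu> \<mu>0"
      by (simp_all add: tv_norm_def)
  qed
  have "tv_norm (ext m t) (ext h t) \<le>
    exp (\<theta> * t0) * (exp (\<theta> * t0) - \<alpha> * exp (- lmax * t0)) ^ nat \<lfloor>t / t0\<rfloor> * tv_norm (ext m 0) (ext h 0)"
    by (rule tv_norm_contraction[OF ext(1)[OF m0 m_solution] ext(1)[OF h0 h_solution] t0_pos \<alpha>_nonneg doeblin t_nonneg])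
  then show ?thesis
    using t_nonneg by (simp add: ext(2)[OF m0 m_solution] ext(3)[OF h0 h_solution]) (simp add: ext_def)
qed

end
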